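(* Let $\mathcal{I}$ satisfy (A1)–(A7). If $P,Q,R$ are distinct finite points such that the composition $PQR$ of the half-turns about $P$, $Q$, $R$ is an involution (i.e. $(PQR)^2=1$), then $P,Q,R$ are collinear.
   Context: $\mathcal{I}$ is an incidence structure of (finite) points and lines. Betweenness: for collinear $A,B,C$, $B$ is between $A$ and $C$ if every line through $B$ meets at least one line of each pair of intersecting lines through $A$ and $C$ respectively; segments and rays are defined as usual from this. Rays $r,s$ with endpoints $R,S$ are parallel if non-collinear and every line meeting one of them meets the other or the segment $\overline{RS}$; lines are parallel if they contain parallel rays. A rimpoint is a pair $(a,b)$ of parallel lines such that some line $\ell$ is parallel to both and some line meets $a,b,\ell$; $(a,b)=(c,d)$ if any two of $a,b,c,d$ are equal or parallel; $(a,b)$ is incident with $\ell$ if $\ell\in\{a,b\}$ or $\ell$ is parallel to both and some line meets $a,b,\ell$. "Point" means finite point or rimpoint; $AB$ is the line through distinct points $A,B$. Axioms: (A1) two distinct points lie on a unique line; (A2) each line is on at least one point; (A3) there exist three non-collinear points and three collinear points; (A4) of three collinear points, at least one has the property that every line through it meets at least one of each pair of intersecting lines through the other two; (A5) if $P$ is not on $\ell$, there are two distinct lines on $P$ not meeting $\ell$ such that each line meeting $\ell$ meets at least one of them; (A6) any two non-collinear rays have a common parallel line; (A7) if $A,\dots,F$ are rimpoints such that $AB\cap DE$, $BC\cap EF$, $CD\cap FA$ exist as finite points, they are collinear. Under these axioms every line carries exactly two rimpoints. Let $\mathcal{O}$ be the set of rimpoints. For a finite point $P$, the half-turn about $P$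 is the permutation of $\mathcal{O}$ sending $X$ to $X^P$, the other rimpoint on the line $XP$; half-turns are denoted by the same letter as the point, and products are composed left to right: $X^{PQ}=(X^P)^Q$. $1$ denotes the identity permutation of $\mathcal{O}$.
   Formalization: Equality of rimpoints (a,b)=(c,d) also requires a line meeting all of a,b,c,d, since otherwise the sides of an ideal triangle identify distinct rimpoints; in (A6) a line containing a ray counts as parallel to it, since (A6) otherwise fails in the Klein model. *)

theory Defs
  imports Main
begin

locale incidence_structure =
  fixes inc :: "'p \<Rightarrow> 'l \<Rightarrow> bool"
begin

definition pts :: "'l \<Rightarrow> 'p set" where
  "pts l = {P. inc P l}"

definition collinear :: "'p \<Rightarrow> 'p \<Rightarrow> 'p \<Rightarrow> bool" where
  "collinear A B C \<longleftrightarrow> (\<exists>l. inc A l \<and> inc B l \<and> inc C l)"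

text \<open>A line does not meet itself. Axiom A5 below depends on this: otherwise
  the line \<open>l\<close> would be one of the lines meeting \<open>l\<close>, and the axiom would be contradictory.\<close>

definition meet_at :: "'l \<Rightarrow> 'l \<Rightarrow> 'p \<Rightarrow> bool" where
  "meet_at l m P \<longleftrightarrow> l \<noteq> m \<and> inc P l \<and> inc P m"

definition meets :: "'l \<Rightarrow> 'l \<Rightarrow> bool" where
  "meets l m \<longleftrightarrow> (\<exists>P. meet_at l m P)"

definition meets_set :: "'l \<Rightarrow> 'p set \<Rightarrow> bool" where
  "meets_set l S \<longleftrightarrow> (\<exists>P\<in>S. inc P l)"

text \<open>Betweenness is strict; segments and rays contain their endpoints.\<close>

definition between :: "'p \<Rightarrow> 'p \<Rightarrow> 'p \<Rightarrow> bool" where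
  "between A B C \<longleftrightarrow> distinct [A, B, C] \<and> collinear A B C \<and>
     (\<forall>k l m. inc B k \<and> inc A l \<and> inc C m \<and> meets l m \<longrightarrow> meets k l \<or> meets k m)"

definition segment :: "'p \<Rightarrow> 'p \<Rightarrow> 'p set" where
  "segment A B = {X. X = A \<or> X = B \<or> between A X B}"

definition ray :: "'p \<Rightarrow> 'p \<Rightarrow> 'p set" where
  "ray R A = {X. X = R \<or> X = A \<or> between R X A \<or> between R A X}"

definition ray_from :: "'p \<Rightarrow> 'p set \<Rightarrow> bool" where
  "ray_from R r \<longleftrightarrow> (\<exists>A. A \<noteq> R \<and> (\<exists>l. inc R l \<and> inc A l) \<and> r = ray R A)"

definition is_ray :: "'p set \<Rightarrow> bool" where
  "is_ray r \<longleftrightarrow> (\<exists>R. ray_from R r)"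

definition collinear_rays :: "'p set \<Rightarrow> 'p set \<Rightarrow> bool" where
  "collinear_rays r s \<longleftrightarrow> (\<exists>l. r \<union> s \<subseteq> pts l)"

definition parallel_rays :: "'p set \<Rightarrow> 'p set \<Rightarrow> bool" where
  "parallel_rays r s \<longleftrightarrow> (\<exists>R S. ray_from R r \<and> ray_from S s \<and> \<not> collinear_rays r s \<and>
     (\<forall>k. meets_set k r \<longrightarrow> meets_set k s \<or> meets_set k (segment R S)) \<and>
     (\<forall>k. meets_set k s \<longrightarrow> meets_set k r \<or> meets_set k (segment R S)))"

definition parallel :: "'l \<Rightarrow> 'l \<Rightarrow> bool" where
  "parallel a b \<longleftrightarrow> (\<exists>r s. parallel_rays r s \<and> r \<subseteq> pts a \<and> s \<subseteq> pts b)"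

text \<open>For A6, a line counts as parallel to a ray also when it contains that ray. If a ray \<open>s\<close>
  is parallel to the ray opposite to \<open>r\<close>, then in the Klein model the only line joining the
  ends of \<open>r\<close> and \<open>s\<close> is the line carrying \<open>r\<close>; without this convention A6 would fail there.\<close>

definition line_parallel_ray :: "'l \<Rightarrow> 'p set \<Rightarrow> bool" where
  "line_parallel_ray l r \<longleftrightarrow> r \<subseteq> pts l \<or> (\<exists>s. s \<subseteq> pts l \<and> parallel_rays r s)"

definition is_rimpair :: "'l \<times> 'l \<Rightarrow> bool" where
  "is_rimpair = (\<lambda>(a, b). parallel a b \<and>
     (\<exists>l. parallel l a \<and> parallel l b \<and> (\<exists>t. meets t a \<and> meets t b \<and> meets t l)))"

text \<open>Equality of the rimpoints given by \<open>(a, b)\<close> and \<open>(c, d)\<close>: any two of the four lines are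
  equal or parallel. The common transversal excludes the sides of an ideal triangle, which are
  pairwise parallel although they do not share an end; without it, \<open>(a, b)\<close> and \<open>(a, c)\<close> would be
  identified for such a triangle and the relation would not be transitive.\<close>

definition rim_eq :: "'l \<times> 'l \<Rightarrow> 'l \<times> 'l \<Rightarrow> bool" where
  "rim_eq = (\<lambda>(a, b) (c, d).
     (\<forall>x\<in>{a, b, c, d}. \<forall>y\<in>{a, b, c, d}. x = y \<or> parallel x y) \<and>
     (\<exists>t. \<forall>x\<in>{a, b, c, d}. meets t x))"

definition rim_rel :: "(('l \<times> 'l) \<times> ('l \<times> 'l)) set" where
  "rim_rel = {(p, q). is_rimpair p \<and> is_rimpair q \<and> rim_eq p q}"

definition rimpoints :: "('l \<times> 'l) set set" where
  "rimpoints = Collect is_rimpair // rim_rel"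

definition rimpair_inc :: "'l \<times> 'l \<Rightarrow> 'l \<Rightarrow> bool" where
  "rimpair_inc = (\<lambda>(a, b) l. l = a \<or> l = b \<or>
     (parallel l a \<and> parallel l b \<and> (\<exists>t. meets t a \<and> meets t b \<and> meets t l)))"

definition rim_inc :: "('l \<times> 'l) set \<Rightarrow> 'l \<Rightarrow> bool" where
  "rim_inc X l \<longleftrightarrow> (\<exists>p\<in>X. rimpair_inc p l)"

text \<open>\<open>rim_join A B l\<close>: the line \<open>l\<close> is \<open>AB\<close>, for rimpoints \<open>A\<close>, \<open>B\<close>.\<close>

definition rim_join :: "('l \<times> 'l) set \<Rightarrow> ('l \<times> 'l) set \<Rightarrow> 'l \<Rightarrow> bool" where
  "rim_join A B l \<longleftrightarrow> A \<in> rimpoints \<and> B \<in> rimpoints \<and> A \<noteq> B \<and> rim_inc A l \<and> rim_inc B l"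

definition halfturn :: "'p \<Rightarrow> ('l \<times> 'l) set \<Rightarrow> ('l \<times> 'l) set" where
  "halfturn P X = (THE Y. Y \<in> rimpoints \<and> Y \<noteq> X \<and>
     (\<exists>l. inc P l \<and> rim_inc X l \<and> rim_inc Y l))"

end

text \<open>In A1 to A6 the points are finite points.\<close>

locale hyperbolic_plane = incidence_structure inc
  for inc :: "'p \<Rightarrow> 'l \<Rightarrow> bool" +
  assumes A1: "A \<noteq> B \<Longrightarrow> \<exists>!l. inc A l \<and> inc B l"
    and A2: "\<exists>P. inc P l"
    and A3_noncollinear: "\<exists>A B C. distinct [A, B, C] \<and> \<not> collinear A B C"
    and A3_collinear: "\<exists>A B C. distinct [A, B, C] \<and> collinear A B C"
    and A4: "distinct [A, B, C] \<Longrightarrow> collinear A B C \<Longrightarrow>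
      between B A C \<or> between A B C \<or> between A C B"
    and A5: "\<not> inc P l \<Longrightarrow>
      \<exists>m n. m \<noteq> n \<and> inc P m \<and> inc P n \<and> \<not> meets m l \<and> \<not> meets n l \<and>
        (\<forall>k. meets k l \<longrightarrow> meets k m \<or> meets k n)"
    and A6: "is_ray r \<Longrightarrow> is_ray s \<Longrightarrow> \<not> collinear_rays r s \<Longrightarrow>
      \<exists>l. line_parallel_ray l r \<and> line_parallel_ray l s"
    and A7: "rim_join A' B' ab \<Longrightarrow> rim_join D' E' de \<Longrightarrow> meet_at ab de P \<Longrightarrow>
      rim_join B' C' bc \<Longrightarrow> rim_join E' F' ef \<Longrightarrow> meet_at bc ef Q \<Longrightarrow>
      rim_join C' D' cd \<Longrightarrow> rim_join F' A' fa \<Longrightarrow> meet_at cd fa R \<Longrightarrow>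
      collinear P Q R"

end

theory Submission
  imports Defs
begin

text \<open>
  Let \<open>U\<close> be an end of the line \<open>PQ\<close>. The product \<open>PQ\<close> fixes \<open>U\<close>, so \<open>D = U\<^sup>R\<close> is the image of \<open>U\<close>
  under \<open>PQR\<close>, and \<open>(PQR)\<^sup>2 = 1\<close> forces the product \<open>PQ\<close> to fix \<open>D\<close>. Hence \<open>D\<^sup>P = D\<^sup>Q\<close>, and the line joining \<open>D\<close> to this
  rimpoint contains \<open>P\<close> and \<open>Q\<close>. So \<open>U\<close> and \<open>D\<close> are the ends of \<open>PQ\<close>, and \<open>R\<close>, which lies on \<open>UD\<close>, is on \<open>PQ\<close>.

  The substance is that rimpoints behave like the ends of lines: a line has exactly two of them,
  two of them are on at most one line, and a point is joined to each of them by a unique line.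
  This follows from A1 to A5. Trichotomy on a line admits, besides the linear order, only a cyclic order
  of exactly four points, which the existence of further points excludes; Pasch's axiom follows by
  playing A4 off against A5. The two lines of A5 are the limiting parallels, their parallelism is
  symmetric and transitive, and three pairwise parallel lines have a common end if and only if they
  have a common transversal.
\<close>

subsection \<open>Betweenness\<close>

context hyperbolic_plane
begin

text \<open>The obstacle is that no order relation is given: betweenness only says that a line
  through \<open>B\<close> cannot miss both of two meeting lines through \<open>A\<close> and
  \<open>C\<close>. A betweenness is therefore refuted by exhibiting three lines, and A5 supplies
  them: through a point off \<open>l\<close> there is a line that misses \<open>l\<close> and meets
  a prescribed line meeting \<open>l\<close>. Two outer forms of Pasch's axiom are obtained from
  such lines. Only then is lying on the same side of a line known to be an equivalence relation, and
  from there on the arguments are those of ordered geometry, with angles described by sides of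
  lines. An end is encoded as the set of all lines running into it, so that incidence with it is
  membership; the classes of pairs from the definition of rimpoints are translated into this form
  once, shortly before the half-turns are treated.\<close>

lemma line_unique: "A \<noteq> B \<Longrightarrow> inc A l \<Longrightarrow> inc B l \<Longrightarrow> inc A m \<Longrightarrow> inc B m \<Longrightarrow> l = m"
  using A1 by blast

lemma meetsI: "inc P l \<Longrightarrow> inc P m \<Longrightarrow> l \<noteq> m \<Longrightarrow> meets l m"
  unfolding meets_def meet_at_def by blast

lemma meetsE: "meets l m \<Longrightarrow> (\<And>P. inc P l \<Longrightarrow> inc P m \<Longrightarrow> l \<noteq> m \<Longrightarrow> thesis) \<Longrightarrow> thesis"
  unfolding meets_def meet_at_def by blast

lemma meets_sym: "meets l m \<Longrightarrow> meets m l"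
  unfolding meets_def meet_at_def by blast

lemma join_exists: obtains l where "inc A l" "inc B l"
proof (cases "A = B")
  case True
  obtain C where "C \<noteq> A" using A3_noncollinear by (metis distinct_length_2_or_more)
  then show ?thesis using A1[of C A] that True by blast
next
  case False
  then show ?thesis using A1 that by blast
qed

lemma off_line: "\<exists>X. \<not> inc X l"
  using A3_noncollinear unfolding collinear_def by blast

lemma other_line: "inc B l \<Longrightarrow> \<exists>b. inc B b \<and> b \<noteq> l"
  by (metis off_line join_exists)

definition limit_pair :: "'p \<Rightarrow> 'l \<Rightarrow> 'l \<Rightarrow> 'l \<Rightarrow> bool" where
  "limit_pair P l m n \<longleftrightarrow> \<not> inc P l \<and> m \<noteq> n \<and> inc P m \<and> inc P n \<and> \<not> meets m l \<and> \<not> meets n l \<and>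
     (\<forall>k. meets k l \<longrightarrow> meets k m \<or> meets k n)"

lemma limit_pair_exists: "\<not> inc P l \<Longrightarrow> \<exists>m n. limit_pair P l m n"
  using A5[of P l] unfolding limit_pair_def by blast

lemma limit_pair_sym: "limit_pair P l m n \<Longrightarrow> limit_pair P l n m"
  unfolding limit_pair_def by blast

text \<open>A5 offers two lines, so a prescribed line \<open>k\<close> can be avoided.\<close>

lemma miss_exists: "\<not> inc P l \<Longrightarrow> \<exists>m. inc P m \<and> \<not> meets m l \<and> m \<noteq> k"
  using limit_pair_exists[of P l] unfolding limit_pair_def by blast

text \<open>The line returned is the one of the two lines of A5 that \<open>k\<close> must meet.
  This is the usual source of witnesses against a betweenness.\<close>

lemma miss_meeting_exists:
  "\<not> inc P l \<Longrightarrow> meets k l \<Longrightarrow> \<exists>m. inc P m \<and> \<not> meets m l \<and> meets k m"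
  using limit_pair_exists[of P l] unfolding limit_pair_def by blast

section \<open>Uniqueness and the first transitivity laws of betweenness\<close>

lemma between_sym: "between A B C \<Longrightarrow> between C B A"
  unfolding between_def collinear_def by (auto dest: meets_sym)

lemma between_distinct: "between A B C \<Longrightarrow> A \<noteq> B \<and> B \<noteq> C \<and> A \<noteq> C"
  unfolding between_def by auto

lemma between_line: "between A B C \<Longrightarrow> \<exists>l. inc A l \<and> inc B l \<and> inc C l"
  unfolding between_def collinear_def by auto

lemma between_inc:
  assumes "between A B C"
  shows "inc A l \<Longrightarrow> inc B l \<Longrightarrow> inc C l" "inc A l \<Longrightarrow> inc C l \<Longrightarrow> inc B l"
    "inc B l \<Longrightarrow> inc C l \<Longrightarrow> inc A l"
  using between_line[OF assms] between_distinct[OF assms] line_unique by metis+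

lemma between_meets:
  "between A B C \<Longrightarrow> inc B k \<Longrightarrow> inc A l \<Longrightarrow> inc C m \<Longrightarrow> meets l m \<Longrightarrow> meets k l \<or> meets k m"
  unfolding between_def by blast

lemma trichotomy:
  "A \<noteq> B \<Longrightarrow> B \<noteq> C \<Longrightarrow> A \<noteq> C \<Longrightarrow> inc A l \<Longrightarrow> inc B l \<Longrightarrow> inc C l \<Longrightarrow>
    between B A C \<or> between A B C \<or> between A C B"
  using A4[of A B C] unfolding collinear_def by auto

text \<open>The two lines witness that \<open>A\<close> and \<open>C\<close> are on the same side of \<open>k\<close>; if \<open>B\<close> is between \<open>A\<close> and
  \<open>C\<close>, there are no such lines.\<close>

lemma two_step_path:
  assumes "between B A C" "inc B k" "\<not> inc A k"
  shows "\<exists>a c. inc A a \<and> inc C c \<and> \<not> meets a k \<and> \<not> meets c k \<and> meets a c"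
proof -
  obtain m n where mn: "limit_pair A k m n" using limit_pair_exists assms by blast
  have "\<not> inc C m"
  proof
    assume "inc C m"
    then have "inc B m" using between_inc[OF assms(1)] mn unfolding limit_pair_def by blast
    then show False using assms mn meetsI unfolding limit_pair_def by metis
  qed
  moreover have "meets n m" using mn meetsI unfolding limit_pair_def by metis
  ultimately obtain c where c: "inc C c" "\<not> meets c m" "meets n c"
    using miss_meeting_exists by blast
  have "\<not> meets k c"
    using between_meets[OF assms(1), of m k c] c mn assms meets_sym unfolding limit_pair_def by blast
  then show ?thesis using c mn meets_sym unfolding limit_pair_def by blast
qed

text \<open>The other order would yield a chain of two meeting lines from \<open>A\<close> to
  \<open>C\<close> that both miss a line \<open>b\<close> through \<open>B\<close>, which
  \<open>between A B C\<close> forbids.\<close>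

lemma between_unique:
  assumes "between A B C" shows "\<not> between B A C"
proof
  assume *: "between B A C"
  obtain l where l: "inc A l" "inc B l" "inc C l" using between_line assms by blast
  obtain b where b: "inc B b" "b \<noteq> l" using other_line l by blast
  have "\<not> inc A b" using b l line_unique between_distinct[OF assms] by blast
  from two_step_path[OF * b(1) this] show False
    using between_meets[OF assms] b meets_sym by blast
qed

lemma between_unique': "between A B C \<Longrightarrow> \<not> between A C B"
  using between_sym between_unique by blast

text \<open>If \<open>c\<close> through \<open>C\<close> missed the meeting lines \<open>b\<close>
  and \<open>d\<close>, a line \<open>a\<close> through \<open>A\<close> missing \<open>b\<close>
  and meeting \<open>d\<close> would violate the first hypothesis in case it meets \<open>c\<close>,
  and the second one otherwise.\<close>

lemma between_trans1:
  assumes "between A B C" "between A C D" shows "between B C D"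
proof -
  obtain l where l: "inc A l" "inc B l" "inc C l" using between_line assms by blast
  have D: "inc D l" using between_inc[OF assms(2)] l by blast
  have dist: "distinct [B, C, D]"
    using between_distinct[OF assms(1)] between_distinct[OF assms(2)] between_unique'[OF assms(1)] assms(2)
    by auto
  have "meets c b \<or> meets c d" if h: "inc C c" "inc B b" "inc D d" "meets b d" for b c d
  proof (rule ccontr)
    assume n: "\<not> (meets c b \<or> meets c d)"
    have "b \<noteq> l" using n h l meetsI by metis
    then have "\<not> inc A b" using l h line_unique between_distinct[OF assms(1)] by blast
    then obtain a where a: "inc A a" "\<not> meets a b" "meets d a"
      using miss_meeting_exists meets_sym h by blast
    have "\<not> meets a c" using between_meets[OF assms(1), of b a c] h a n meets_sym by blast
    then show False using between_meets[OF assms(2), of c a d] h a n meets_sym by blast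
  qed
  then show ?thesis using dist l D unfolding between_def collinear_def by blast
qed

lemma between_trans2:
  assumes "between A B C" "between A C D" shows "between A B D"
proof -
  have 1: "between B C D" using between_trans1 assms by blast
  obtain l where l: "inc A l" "inc B l" "inc C l" using between_line assms by blast
  have D: "inc D l" using between_inc[OF assms(2)] l by blast
  note d = between_distinct[OF assms(1)] between_distinct[OF assms(2)] between_distinct[OF 1]
  consider "between B A D" | "between A B D" | "between A D B"
    using trichotomy[of A B D l] l D d by blast
  then show ?thesis
  proof cases
    case 1
    then have "between C A B" using between_trans1[of D C A B] assms(2) between_sym by blast
    then show ?thesis using between_unique' assms(1) between_sym by blast
  next
    case 3
    then have "between C D A" using between_trans1[of B C D A] 1 between_sym by blast
    then show ?thesis using between_unique' assms(2) between_sym by blast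
  qed
qed

text \<open>A line \<open>w\<close> through \<open>V\<close> that misses \<open>p\<close> crosses
  \<open>v\<close>, so by A5 it meets one of the pair. As \<open>X\<close> is between
  \<open>U\<close> and \<open>V\<close>, the line \<open>p\<close> must meet that same line.\<close>

lemma between_meets_pair:
  assumes "between U X V" "inc V v" "\<not> inc U v" "limit_pair U v u1 u2" "inc X p" "\<not> inc V p"
  shows "meets p u1 \<or> meets p u2"
proof (rule ccontr)
  assume n: "\<not> (meets p u1 \<or> meets p u2)"
  obtain w where w: "inc V w" "\<not> meets w p" "w \<noteq> v" using miss_exists assms by metis
  have "meets w v" using w assms meetsI by blast
  then obtain u where "inc U u" "meets w u" "\<not> meets p u" using assms n unfolding limit_pair_def by blast
  then show False using between_meets[OF assms(1), of p u w] w assms meets_sym by blast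
qed

text \<open>One of the two lines that A5 gives for \<open>U\<close> and \<open>r\<close> meets
  \<open>p\<close>, and it misses \<open>r\<close>. Since \<open>W\<close> is between
  \<open>U\<close> and \<open>O'\<close>, the line \<open>r\<close> has to meet \<open>p\<close>
  instead.\<close>

lemma outer_pasch1:
  assumes "between U X V" "between U W O'" "inc X p" "inc O' p" "inc V r" "inc W r" "\<not> inc U r" "\<not> inc V p"
  shows "meets p r"
proof (rule ccontr)
  assume n: "\<not> meets p r"
  obtain u1 u2 where u: "limit_pair U r u1 u2" using limit_pair_exists assms by blast
  then obtain u where "inc U u" "\<not> meets u r" "meets p u"
    using between_meets_pair[OF assms(1) _ _ u] assms unfolding limit_pair_def by blast
  then show False using between_meets[OF assms(2), of r u p] n assms meets_sym by blast
qed

section \<open>Existence of further points on a line\<close>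

lemma new_point:
  assumes "inc A l" "inc A g" "g \<noteq> l" "\<not> inc Y g"
  shows "\<exists>Z y. inc Z l \<and> Z \<noteq> A \<and> inc Y y \<and> inc Z y \<and> \<not> meets y g"
proof -
  have "meets l g" using assms meetsI by blast
  then obtain y where y: "inc Y y" "\<not> meets y g" "meets l y"
    using miss_meeting_exists assms by blast
  then obtain Z where "inc Z l" "inc Z y" by (blast elim: meetsE)
  moreover have "Z \<noteq> A" using calculation y assms meetsI by metis
  ultimately show ?thesis using y by blast
qed

lemma second_point:
  assumes "inc A l" shows "\<exists>B. inc B l \<and> B \<noteq> A"
proof -
  obtain g where g: "inc A g" "g \<noteq> l" using other_line assms by blast
  obtain Y where Y: "\<not> inc Y g" using off_line by blast
  show ?thesis using new_point[OF assms g Y] by blast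
qed

text \<open>A3 gives three collinear points on some line \<open>t\<close> only. If \<open>l\<close>
  had just two points, then \<open>B\<close> would be off \<open>t\<close>, and the line
  \<open>BE\<close> would have just two points as well; as it crosses \<open>t\<close> at
  \<open>E\<close>, the claim \<open>*\<close> excludes this.\<close>

lemma third_point:
  assumes "inc A l" "inc B l" shows "\<exists>C. inc C l \<and> C \<noteq> A \<and> C \<noteq> B"
proof -
  \<comment> \<open>A line through \<open>Z\<close> missing \<open>AY\<close> would have to meet
    \<open>l\<close> away from \<open>A\<close>, hence at \<open>B\<close>. So it would be
    \<open>b\<close>, which meets \<open>AY\<close> at \<open>Y\<close>.\<close>
  have *: False if h: "A \<noteq> B" "inc A l" "inc B l" "\<forall>C. inc C l \<longrightarrow> C = A \<or> C = B"
    "inc B b" "b \<noteq> l" "inc Y b" "inc Z b" "Y \<noteq> B" "Z \<noteq> B" "Y \<noteq> Z" for A B l b Y Z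
  proof -
    obtain g where g: "inc A g" "inc Y g" using join_exists by blast
    have "g \<noteq> l" "\<not> inc Z g" using g h line_unique[of Y B b l] line_unique[of Y Z g b] line_unique[of A B l b] by blast+
    then obtain W z where w: "inc W l" "W \<noteq> A" "inc Z z" "inc W z" "\<not> meets z g"
      using new_point[OF h(2) g(1)] by blast
    have "W = B" using w h by blast
    then have "z = b" using line_unique[of Z B z b] w h by blast
    then show False using meetsI[of Y b g] w g h \<open>\<not> inc Z g\<close> by blast
  qed
  obtain E F G t where t: "E \<noteq> F" "F \<noteq> G" "E \<noteq> G" "inc E t" "inc F t" "inc G t"
    using A3_collinear unfolding collinear_def by auto
  show ?thesis
  proof (cases "A = B")
    case True then show ?thesis using second_point assms by blast
  next
    case False
    show ?thesis
    proof (rule ccontr)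
      assume "\<not> ?thesis"
      then have l: "\<forall>C. inc C l \<longrightarrow> C = A \<or> C = B" by blast
      then have tl: "t \<noteq> l" using t by metis
      have B: "\<not> inc B t"
      proof
        assume "inc B t"
        then show False using *[OF False assms l, of t] tl t by metis
      qed
      obtain b where b: "inc B b" "inc E b" using join_exists by blast
      have bt: "b \<noteq> t" using B b by blast
      have "b \<noteq> l \<or> inc E l" using b by blast
      show False
      proof (cases "b = l")
        case True
        have "E = A" using True b l B t by metis
        then show False
          using *[of B A l t F G] False assms l t tl by metis
      next
        case False
        have "\<forall>C. inc C b \<longrightarrow> C = B \<or> C = E"
          using *[OF \<open>A \<noteq> B\<close> assms l b(1) False _ b(2)] B t by metis
        then show False using *[of B E b t F G] b bt B t by metis
      qed
    qed
  qed
qed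

text \<open>If \<open>A\<close>, \<open>B\<close>, \<open>C\<close> were all the points of
  \<open>l\<close>, a line known to meet \<open>l\<close> would have at most three places to do so.
  This forces \<open>A\<close> to be between \<open>T\<close> and \<open>P\<close> on
  \<open>a\<close>. But the lines \<open>s\<close> and \<open>c\<close> from these points meet at
  \<open>C\<close>, and some line through \<open>A\<close> misses both of them.\<close>

lemma fourth_point_aux:
  assumes "between A B C" "inc A l" "inc B l" "inc C l"
  shows "\<exists>D. inc D l \<and> D \<noteq> A \<and> D \<noteq> B \<and> D \<noteq> C"
proof (rule ccontr)
  assume "\<not> ?thesis"
  then have l: "\<And>D. inc D l \<Longrightarrow> D = A \<or> D = B \<or> D = C" by blast
  note d = between_distinct[OF assms(1)]
  obtain P where P: "\<not> inc P l" using off_line by blast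
  obtain a where a: "inc P a" "inc A a" using join_exists by blast
  obtain c where c: "inc P c" "inc C c" using join_exists by blast
  have ac: "meets a c" "a \<noteq> l" "c \<noteq> l" using a c P d assms line_unique meetsI by metis+
  have nin: "\<not> inc B c" "\<not> inc C a" "\<not> inc B a" "\<not> inc A c"
    using a c P d assms line_unique by metis+
  obtain b1 b2 where b: "limit_pair B c b1 b2" using limit_pair_exists nin by blast
  have bc: "inc B b1" "inc B b2" "\<not> meets b1 c" "\<not> meets b2 c" "b1 \<noteq> b2"
    using b unfolding limit_pair_def by auto
  have ba: "meets b1 a" "meets b2 a" using between_meets[OF assms(1) _ a(2) c(2) ac(1)] bc by blast+
  have bl: "b1 \<noteq> l" "b2 \<noteq> l" using bc c ac assms meetsI by metis+
  obtain T where T: "inc T b1" "inc T a" using ba by (blast elim: meetsE)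
  have "T \<noteq> B" "T \<noteq> A" using T nin bl bc assms d line_unique by metis+
  have "T \<noteq> P" using T bc c nin meetsI by metis
  have "\<not> inc T l" using T \<open>T \<noteq> A\<close> a ac assms line_unique by metis
  obtain s where s: "inc T s" "inc C s" using join_exists by blast
  have sl: "s \<noteq> l" using s \<open>\<not> inc T l\<close> by blast
  have Ps: "\<not> inc P s" using s a T nin \<open>T \<noteq> P\<close> line_unique by metis
  obtain Z y where Z: "inc Z l" "Z \<noteq> C" "inc P y" "inc Z y" "\<not> meets y s"
    using new_point[OF assms(4) s(2) sl Ps] by blast
  have "Z \<noteq> A"
  proof
    assume "Z = A"
    then have "y = a" using Z a P assms line_unique by metis
    then show False using Z T s a Ps meetsI by metis
  qed
  then have ZB: "Z = B" using Z l by blast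
  have "\<not> between A P T"
    using outer_pasch1[of A P T B C c b1] bc c T assms a nin \<open>T \<noteq> P\<close> line_unique meets_sym bl by metis
  moreover have "\<not> between A T P"
  proof
    assume "between A T P"
    moreover have "\<not> inc A s" using s sl d assms line_unique by metis
    moreover have "\<not> inc C y" using Z ZB P d assms line_unique by metis
    ultimately show False
      using outer_pasch1[OF assms(1), of T P y s] Z ZB s by blast
  qed
  ultimately have TAP: "between T A P"
    using trichotomy[of T A P a] T a \<open>T \<noteq> P\<close> \<open>T \<noteq> A\<close> P assms between_sym by metis
  have "\<not> inc T b2" using T bc \<open>T \<noteq> B\<close> line_unique by metis
  then obtain Z' z where z: "inc Z' l" "Z' \<noteq> B" "inc T z" "inc Z' z" "\<not> meets z b2"
    using new_point[OF assms(3) bc(2) bl(2)] by blast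
  have "Z' \<noteq> A"
  proof
    assume "Z' = A"
    then have "z = a" using z a T \<open>T \<noteq> A\<close> line_unique by metis
    then show False using z ba meets_sym by blast
  qed
  then have "z = s" using z l s \<open>\<not> inc T l\<close> line_unique by metis
  then have sb: "\<not> meets s b2" using z by blast
  have "\<not> inc A b2" using bc bl d assms line_unique by metis
  then obtain a2 where a2: "inc A a2" "\<not> meets a2 b2" using miss_exists by blast
  have "\<not> meets s a2" "\<not> meets c a2"
    using between_meets[OF between_sym[OF assms(1)] bc(2)] s c a2 sb bc meets_sym by metis+
  moreover have "meets s c" using s c T Ps meetsI by metis
  ultimately show False using between_meets[OF TAP a2(1) s(1) c(1)] meets_sym by blast
qed

lemma fourth_point:
  assumes "inc A l" "inc B l" "inc C l"
  shows "\<exists>D. inc D l \<and> D \<noteq> A \<and> D \<noteq> B \<and> D \<noteq> C"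
proof (cases "A \<noteq> B \<and> B \<noteq> C \<and> A \<noteq> C")
  case True
  then show ?thesis using trichotomy[of A B C l] fourth_point_aux assms by metis
next
  case False
  then show ?thesis using third_point assms by metis
qed

text \<open>Otherwise \<open>D\<close> is between any two other points of \<open>d\<close>. Three
  other points exist by \<open>fourth_point\<close>, and whatever their order is,
  \<open>between_trans1\<close> turns it into an order that starts at \<open>D\<close>.\<close>

lemma between_from:
  assumes "inc D d" shows "\<exists>Y P. inc Y d \<and> inc P d \<and> between D Y P"
proof (rule ccontr)
  assume n: "\<not> ?thesis"
  obtain W where W: "inc W d" "W \<noteq> D" using second_point assms by blast
  obtain P where P: "inc P d" "P \<noteq> D" "P \<noteq> W" using third_point assms W by metis
  obtain T where T: "inc T d" "T \<noteq> D" "T \<noteq> W" "T \<noteq> P" using fourth_point assms W P by metis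
  have b: "between X D Y" if "inc X d" "inc Y d" "X \<noteq> Y" "X \<noteq> D" "Y \<noteq> D" for X Y
    using trichotomy[of D X Y d] that n assms between_sym by metis
  have "\<not> between X Y Z" if "inc X d" "inc Y d" "inc Z d" "X \<noteq> D" "Y \<noteq> D" "Z \<noteq> D" for X Y Z
  proof
    assume XYZ: "between X Y Z"
    have "between X D Y" "between Y D Z" using b that between_distinct[OF XYZ] by blast+
    then have "between D Y Z" using between_trans1 XYZ by blast
    then show False using n that by blast
  qed
  then show False using trichotomy[of W P T d] W P T by metis
qed

text \<open>Both lines that A5 gives for \<open>Y\<close> and \<open>g = PA\<close> must meet
  \<open>l\<close>, since \<open>Y\<close> is between \<open>D\<close> and \<open>P\<close>. They do
  so at points not beyond \<open>A\<close>, because otherwise \<open>outer_pasch1\<close> would make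
  them meet \<open>g\<close>. Two points are produced because one of them may be the remaining point
  of a cyclic quadruple.\<close>

lemma new_points_not_beyond:
  assumes "between D Y P" "inc D l" "inc A l" "A \<noteq> D" "\<not> inc P l"
  shows "\<exists>X X'. X \<noteq> X' \<and> inc X l \<and> inc X' l \<and> X \<notin> {A, D} \<and> X' \<notin> {A, D} \<and>
    \<not> between D A X \<and> \<not> between D A X'"
proof -
  obtain d where d: "inc D d" "inc Y d" "inc P d" using between_line assms by blast
  note dd = between_distinct[OF assms(1)]
  obtain g where g: "inc P g" "inc A g" using join_exists by blast
  have Yg: "\<not> inc Y g" using d dd g assms line_unique by metis
  have Yl: "\<not> inc Y l" using d dd assms line_unique by metis
  obtain y1 y2 where y: "limit_pair Y g y1 y2" using limit_pair_exists Yg by blast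
  have "\<exists>X. inc X l \<and> inc X y \<and> X \<notin> {A, D} \<and> \<not> between D A X"
    if "inc Y y" "\<not> meets y g" for y
  proof -
    have "meets l g" using assms g meetsI by metis
    then have "meets y l" using between_meets[OF assms(1)] that g assms by blast
    then obtain X where X: "inc X l" "inc X y" by (blast elim: meetsE)
    have "X \<noteq> A" using X that g Yg meetsI by metis
    moreover have "X \<noteq> D" using X that d dd g Yg line_unique meetsI by metis
    moreover have "\<not> between D A X"
    proof
      assume DAX: "between D A X"
      have "\<not> inc D y" using that d dd g Yg line_unique meetsI by metis
      moreover have "\<not> inc X g" using X that g Yg meetsI by metis
      ultimately show False
        using outer_pasch1[OF DAX assms(1), of g y] g that X meets_sym by blast
    qed
    ultimately show ?thesis using X by blast
  qed
  then obtain X X' where X: "inc X l" "inc X y1" "X \<notin> {A, D}" "\<not> between D A X"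
    "inc X' l" "inc X' y2" "X' \<notin> {A, D}" "\<not> between D A X'"
    using y unfolding limit_pair_def by meson
  moreover have "X \<noteq> X'" using X y Yl line_unique unfolding limit_pair_def by metis
  ultimately show ?thesis by blast
qed

section \<open>Exclusion of cyclic quadruples\<close>

lemma cyclic_step:
  assumes "between A B C" "between B C D" "between C D A" "between D A B"
    "inc A l" "inc B l" "inc E l" "E \<noteq> A" "E \<noteq> B" "E \<noteq> C" "E \<noteq> D"
  shows "\<not> between A E B"
proof
  assume AEB: "between A E B"
  have C: "inc C l" "inc D l" using between_inc assms by metis+
  have 1: "between E B C" "between A E C"
    using between_trans1[OF AEB assms(1)] between_trans2[OF AEB assms(1)] by auto
  have BAD: "between B A D" using assms between_sym by blast
  have 2: "between E A D" "between B E D"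
    using between_trans1[OF between_sym[OF AEB] BAD] between_trans2[OF between_sym[OF AEB] BAD] by auto
  have "C \<noteq> D" using between_distinct assms by blast
  then consider "between C D E" | "between D C E" | "between C E D"
    using trichotomy[of C D E l] C assms by blast
  then show False
  proof cases
    case 1
    then have "between A D C" "between E A C"
      using between_trans1[of E A D C] between_trans2[of E A D C] 2 between_sym by blast+
    then show False using \<open>between A E C\<close> between_unique by blast
  next
    case 2
    then have "between C E B" using between_trans1[of D C E B] \<open>between B E D\<close> between_sym by blast
    then show False using 1 between_unique between_sym by blast
  next
    case 3
    then have "between E D A" using between_trans1[of C E D A] assms by blast
    then show False using 2 between_unique' by blast
  qed
qed

text \<open>As for Menger's pseudo-linear quadruples, a cyclic quadruple excludes a fifth point.\<close>

lemma cyclic_no_fifth_point: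
  assumes "between A B C" "between B C D" "between C D A" "between D A B"
    "inc A l" "inc B l" "inc E l" "E \<noteq> A" "E \<noteq> B" "E \<noteq> C" "E \<noteq> D"
  shows False
proof -
  have C: "inc C l" "inc D l" using between_inc assms by metis+
  note d = between_distinct[OF assms(1)] between_distinct[OF assms(2)]
    between_distinct[OF assms(3)] between_distinct[OF assms(4)]
  have n: "\<not> between A E B" "\<not> between B E C" "\<not> between C E D" "\<not> between D E A"
    using cyclic_step[of A B C D l E] cyclic_step[of B C D A l E] cyclic_step[of C D A B l E]
      cyclic_step[of D A B C l E] assms C by blast+
  have e: "between A B E \<or> between B A E" "between B C E \<or> between C B E"
    "between C D E \<or> between D C E" "between D A E \<or> between A D E"
    using trichotomy[of A B E l] trichotomy[of B C E l] trichotomy[of C D E l] trichotomy[of D A E l]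
      n d assms C by metis+
  have t: "between E X Y \<Longrightarrow> between E Y Z \<Longrightarrow> between X Y Z" for X Y Z
    using between_trans1 by blast
  have x: "between Y X E \<Longrightarrow> between Y E Z \<Longrightarrow> between X E Z" for X Y Z
    using between_trans1 by blast
  note u = between_unique between_unique' between_sym
  have AC: "between E A C \<or> between E C A \<or> between A E C"
    using trichotomy[of A C E l] d assms C u(3) by metis
  have *: False if "between E B' D'" "B' = B \<and> D' = D \<or> B' = D \<and> D' = B" for B' D'
  proof -
    have "\<not> between E A B'" "\<not> between E C B'" "\<not> between E D' A" "\<not> between E D' C"
      using t that assms(1-4) u by metis+
    then have "between E B' A" "between E B' C" "between E A D'" "between E C D'"
      using e that(2) u(3) by metis+
    moreover have "\<not> between E A C" "\<not> between E C A"
      using t calculation that(2) assms(1-4) u by metis+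
    ultimately show False using AC x[of A B' C] n that(2) u(3) by metis
  qed
  have "\<not> between B E D"
  proof
    assume BED: "between B E D"
    then have "\<not> between B A E" "\<not> between B C E" "\<not> between D A E" "\<not> between D C E"
      using x n u(3) by metis+
    then have 1: "between A B E" "between C B E" "between A D E" "between C D E"
      using e u(3) by metis+
    then have "\<not> between E A C" "\<not> between E C A" using t assms(1-4) u by metis+
    then show False using AC x[of A B C] 1 n by blast
  qed
  then show False using *[of B D] *[of D B] trichotomy[of B D E l] d assms C u(3) by metis
qed

text \<open>A fifth point comes from \<open>new_points_not_beyond\<close>: a point that is not
  beyond \<open>A\<close> as seen from \<open>D\<close> is not \<open>B\<close>, and of two such
  points one is not \<open>C\<close>.\<close>

lemma no_cyclic_quadruple:
  assumes "between A B C" "between B C D" "between C D A" "between D A B"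
  shows False
proof -
  obtain l where l: "inc A l" "inc B l" "inc C l" using between_line assms by blast
  have D: "inc D l" using between_inc assms l by metis
  obtain d where d: "inc D d" "d \<noteq> l" using other_line D by blast
  obtain Y P where YP: "inc Y d" "inc P d" "between D Y P" using between_from d by blast
  have P: "\<not> inc P l" using YP d D between_distinct line_unique by metis
  obtain X X' where X: "X \<noteq> X'" "inc X l" "inc X' l" "X \<notin> {A, D}" "X' \<notin> {A, D}"
    "\<not> between D A X" "\<not> between D A X'"
    using new_points_not_beyond[OF YP(3) D l(1) _ P] between_distinct[OF assms(4)] by metis
  have "X \<noteq> B" "X' \<noteq> B" using X assms(4) by auto
  then obtain E where "inc E l" "E \<noteq> A" "E \<noteq> B" "E \<noteq> C" "E \<noteq> D"
    using X by (cases "X = C") auto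
  then show False using cyclic_no_fifth_point[OF assms l(1,2)] by blast
qed

text \<open>Uniqueness and the earlier laws leave \<open>between D A B\<close> as the only
  alternative. It makes \<open>D\<close> lie between \<open>A\<close> and \<open>C\<close>, and this
  closes a cyclic quadruple.\<close>

lemma between_trans3:
  assumes "between A B C" "between B C D" shows "between A B D"
proof -
  obtain l where l: "inc A l" "inc B l" "inc C l" using between_line assms by blast
  have D: "inc D l" using between_inc assms l by metis
  note d = between_distinct[OF assms(1)] between_distinct[OF assms(2)]
  have "A \<noteq> D" using assms between_unique between_unique' between_sym by metis
  have ABD: "\<not> between A D B"
    using between_trans2[of B C D A] assms between_sym[of A D B] between_sym[of B C A]
      between_unique' by blast
  have ACD: "\<not> between C A D"
    using between_trans2[of C B A D] assms between_sym[of A B C] between_unique by blast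
  have "\<not> between A C D" if "between D A B"
    using between_trans1[of D C A B] that assms between_sym[of A C D] between_sym[of C A B]
      between_unique by blast
  then have "\<not> between D A B"
    using trichotomy[of A C D l] ACD no_cyclic_quadruple assms l D d \<open>A \<noteq> D\<close> between_sym by metis
  then show ?thesis using trichotomy[of A B D l] ABD l D d \<open>A \<noteq> D\<close> between_sym by metis
qed

lemma between_cases:
  assumes "between A X B" "inc A l" "inc B l" "inc C l" "C \<noteq> X"
  shows "between A X C \<or> between C X B"
proof (cases "C = A")
  case True then show ?thesis using assms by blast
next
  case False
  have "inc X l" using between_inc assms by metis
  then consider "between X A C" | "between A X C" | "between A C X"
    using trichotomy[of A X C l] between_distinct[OF assms(1)] assms False by metis
  then show ?thesis
  proof cases
    case 1
    then show ?thesis using between_trans3[of B X A C] assms(1) between_sym by blast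
  next
    case 3
    then show ?thesis using between_trans1 assms(1) by blast
  qed blast
qed

subsection \<open>Sides of a line\<close>

lemma not_between_if_missed:
  assumes "inc B k" "inc A l" "inc C m" "meets l m" "\<not> meets k l" "\<not> meets k m"
  shows "\<not> between A B C"
  using between_meets assms by blast

text \<open>The contradiction is found on \<open>y\<close>. Every line through \<open>V\<close>
  other than \<open>v\<close> that misses \<open>q\<close> meets \<open>y\<close>. Two such lines,
  \<open>v2\<close> which also misses \<open>p\<close> and \<nu> which meets \<open>p\<close>, give
  points \<open>N2\<close> and \<open>N1\<close> of \<open>y\<close>, and none of \<open>U\<close>,
  \<open>N1\<close>, \<open>N2\<close> is between the other two.\<close>

lemma outer_pasch2_aux:
  assumes UXV: "between U X V" and OVW: "between O' V W"
    and t: "inc U t" "inc V t" "\<not> inc W t"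
    and p: "inc X p" "inc O' p" and q: "inc U q" "inc W q" "\<not> meets p q"
    and w: "inc V w" "inc W w"
    and v: "inc V v" "\<not> meets v p" and qy: "limit_pair U v q y" and y: "\<not> meets y w" "meets p y"
  shows False
proof -
  note d = between_distinct[OF UXV] between_distinct[OF OVW]
  have X: "inc X t" and O: "inc O' w" using between_inc t w UXV OVW by metis+
  have tw: "t \<noteq> w" using t w by blast
  have Vp: "\<not> inc V p" using line_unique[of V X p t] line_unique[of V O' p w] tw p X O t w d by metis
  have Up: "\<not> inc U p" using line_unique[of U X p t] Vp p X t d by metis
  have pq: "p \<noteq> q" using Up q by blast
  have Vq: "\<not> inc V q" using line_unique[of U V q t] q t d by metis
  have "meets t p" using meetsI[of X t p] X p Vp t by metis
  have v_misses: "inc V v' \<Longrightarrow> \<not> meets v' p \<Longrightarrow> \<not> meets q v'" for v'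
    using between_meets[OF UXV p(1) q(1), of v'] q(3) meets_sym by blast
  have qv: "inc U y" "q \<noteq> y" "\<not> meets q v" "\<not> meets y v" "\<not> inc U v"
    "\<And>k. meets k v \<Longrightarrow> meets k q \<or> meets k y" using qy unfolding limit_pair_def by auto
  have Vy: "\<not> inc V y" using qv meetsI[of V y v] v by metis
  have Wv: "\<not> inc W v" using qv meetsI[of W q v] q Vq v by metis
  have Wy: "\<not> inc W y" using y meetsI[of W y w] w Vy by metis
  have w_misses: "\<not> meets n p" if "inc W n" "\<not> meets n v" for n
    using between_meets[OF OVW v(1) p(2) that(1)] v that meets_sym by blast
  \<comment> \<open>The line \<open>g\<close> crosses \<open>v\<close> at \<open>V\<close> and
    misses \<open>q\<close>, so A5 makes it meet \<open>y\<close>, say at \<open>N\<close>. If the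
    line \<open>n = NW\<close> met \<open>v\<close> at \<open>E\<close>, the points
    \<open>W\<close>, \<open>E\<close>, \<open>N\<close> would have no possible order; hence it
    misses \<open>v\<close>, and then also \<open>p\<close>.\<close>
  have L1: "\<exists>N n. inc N g \<and> inc N y \<and> inc N n \<and> inc W n \<and> \<not> meets n v \<and> \<not> meets n p \<and>
      N \<noteq> W \<and> N \<noteq> U" if g: "inc V g" "\<not> meets q g" "g \<noteq> v" for g
  proof -
    have gq: "g \<noteq> q" using g Vq by blast
    have "meets g v" using g v meetsI by blast
    then have "meets g y" using qv g meets_sym by blast
    then obtain N where N: "inc N g" "inc N y" by (blast elim: meetsE)
    have NW: "N \<noteq> W" "N \<noteq> U" using N q g gq meetsI[of _ q g] by metis+
    obtain n where n: "inc N n" "inc W n" using join_exists by blast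
    have "\<not> meets n v"
    proof
      assume "meets n v"
      then obtain E where E: "inc E n" "inc E v" by (blast elim: meetsE)
      have "E \<noteq> W" using E Wv by blast
      have "E \<noteq> N" using E N qv meetsI[of N y v] Vy v by metis
      have "q \<noteq> w" using Vq w by blast
      have "meets q y" using qv q meetsI by blast
      moreover have "meets v g" using v g meetsI[of V v g] by blast
      moreover have "meets w v" using v w meetsI[of V w v] Wv by blast
      ultimately have "\<not> between W E N" "\<not> between E W N" "\<not> between W N E"
        using not_between_if_missed[of E v W q N y] not_between_if_missed[of W q E v N g]
          not_between_if_missed[of N y W w E v] E N q g w qv y meets_sym by blast+
      then show False using trichotomy[of W E N n] E n \<open>E \<noteq> W\<close> \<open>E \<noteq> N\<close> NW by metis
    qed
    then show ?thesis using N NW n w_misses by blast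
  qed
  obtain v2 where v2: "inc V v2" "\<not> meets v2 p" "v2 \<noteq> v" using miss_exists Vp by metis
  then obtain N2 n2 where N2: "inc N2 v2" "inc N2 y" "inc N2 n2" "inc W n2" "\<not> meets n2 v"
    "\<not> meets n2 p" "N2 \<noteq> W" "N2 \<noteq> U" using L1 v_misses by blast
  obtain \<nu>1 \<nu>2 where "limit_pair V q \<nu>1 \<nu>2" using limit_pair_exists Vq by blast
  then obtain \<nu> where \<nu>: "inc V \<nu>" "\<not> meets \<nu> q" "meets p \<nu>"
    using between_meets_pair[OF between_sym[OF UXV] q(1) Vq _ p(1) Up] unfolding limit_pair_def by blast
  have "\<nu> \<noteq> v" using \<nu> v meets_sym by blast
  then obtain N1 n1 where N1: "inc N1 \<nu>" "inc N1 y" "inc N1 n1" "inc W n1" "\<not> meets n1 v"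
    "\<not> meets n1 p" "N1 \<noteq> W" "N1 \<noteq> U" using L1 \<nu> meets_sym by blast
  have "\<nu> \<noteq> v2" using \<nu> v2 meets_sym by blast
  have VN: "V \<noteq> N1" "V \<noteq> N2" using Vy N1 N2 by blast+
  have "N1 \<noteq> N2" using line_unique[of V N1 \<nu> v2] N1 N2 \<nu> v2 VN \<open>\<nu> \<noteq> v2\<close> by blast
  have "n1 \<noteq> n2" using line_unique[of N1 N2 n1 y] N1 N2 \<open>N1 \<noteq> N2\<close> Wy by blast
  have qn: "q \<noteq> n1" "q \<noteq> n2"
    using line_unique[of N1 U q y] line_unique[of N2 U q y] N1 N2 q qv by blast+
  have Vn: "\<not> inc V n1" "\<not> inc V n2" using N1 N2 v Wv meetsI[of V _ v] by metis+
  have pn: "p \<noteq> n1" "p \<noteq> n2"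
    using N1 N2 v_misses w_misses p O line_unique[of O' W p w] w d Vp by metis+
  obtain \<Pi> where \<Pi>: "inc \<Pi> p" "inc \<Pi> \<nu>" using \<nu> by (blast elim: meetsE)
  have \<Pi>d: "\<Pi> \<noteq> V" "\<Pi> \<noteq> N1" using \<Pi> Vp N1 pn meetsI[of N1 n1 p] by blast+
  have m: "meets q n1" "meets q n2" "meets n1 n2" "meets \<nu> v2" "meets t p"
    using meetsI[of W] meetsI[of V] N1 N2 q qn \<open>n1 \<noteq> n2\<close> \<nu> v2 \<open>\<nu> \<noteq> v2\<close> \<open>meets t p\<close> by blast+
  have "\<not> between \<Pi> V N1"
    using not_between_if_missed[of V v \<Pi> p N1 y] v \<Pi> N1 y qv meets_sym by blast
  moreover have "\<not> between V N1 \<Pi>"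
  proof
    assume b: "between V N1 \<Pi>"
    have "meets n1 t" using between_meets[OF b N1(3) t(2) \<Pi>(1) m(5)] N1 by blast
    then obtain E where E: "inc E n1" "inc E t" by (blast elim: meetsE)
    have "E \<noteq> X" using E N1 p pn meetsI[of X n1 p] by blast
    have "\<not> between E X U"
      using not_between_if_missed[of X p E n1 U q] E p q N1 m meets_sym by blast
    then have "between V X E"
      using between_cases[OF UXV t(1) t(2) E(2) \<open>E \<noteq> X\<close>] between_sym by blast
    moreover have "\<not> inc E p" using E t X p d \<open>E \<noteq> X\<close> line_unique[of E X p t] Up by blast
    ultimately show False
      using outer_pasch1[OF _ b p(1) \<Pi>(1) E(1) N1(3)] Vn N1 meets_sym by blast
  qed
  ultimately have V\<Pi>N: "between V \<Pi> N1"
    using trichotomy[of V \<Pi> N1 \<nu>] \<nu> \<Pi> N1 \<Pi>d VN between_sym by metis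
  have "\<not> between N1 U N2"
    using not_between_if_missed[of U q N1 \<nu> N2 v2] q N1 N2 m \<nu> v_misses v2 meets_sym by blast
  moreover have "\<not> between U N2 N1"
  proof
    assume "between U N2 N1"
    then have "meets v2 n1"
      using between_meets[of U N2 N1 v2 q n1] N2 q N1 m v_misses v2 meets_sym by blast
    then show False
      using not_between_if_missed[of \<Pi> p V v2 N1 n1] V\<Pi>N \<Pi> v2 N1 meets_sym by blast
  qed
  moreover have "\<not> between U N1 N2"
  proof
    assume "between U N1 N2"
    then have "meets \<nu> n2"
      using between_meets[of U N1 N2 \<nu> q n2] N2 q N1 m \<nu> meets_sym by blast
    then obtain E where E: "inc E \<nu>" "inc E n2" by (blast elim: meetsE)
    have "E \<noteq> \<Pi>" using E N2 \<Pi> pn meetsI[of \<Pi> n2 p] by blast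
    have "meets v2 n2" using meetsI[of N2 v2 n2] N2 Vn v2 by blast
    then have "\<not> between V \<Pi> E"
      using not_between_if_missed[of \<Pi> p V v2 E n2] \<Pi> v2 E N2 meets_sym by blast
    moreover have "\<not> between E \<Pi> N1"
      using not_between_if_missed[of \<Pi> p E n2 N1 n1] \<Pi> E N1 N2 m meets_sym by blast
    ultimately show False
      using between_cases[OF V\<Pi>N \<nu>(1) N1(1) E(1) \<open>E \<noteq> \<Pi>\<close>] by blast
  qed
  ultimately show False
    using trichotomy[of N1 U N2 y] N1 N2 qv \<open>N1 \<noteq> N2\<close> between_sym by metis
qed

text \<open>The line \<open>VW\<close> meets one of the two lines that A5 gives for \<open>U\<close> and \<open>v\<close>, and \<open>p\<close> meets the other one.
  Replacing \<open>q\<close> by the former leads to the situation of the previous lemma.\<close>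

lemma outer_pasch2:
  assumes UXV: "between U X V" and OVW: "between O' V W"
    and t: "inc U t" "inc V t" "\<not> inc W t"
    and p: "inc X p" "inc O' p" and q: "inc U q" "inc W q"
  shows "meets p q"
proof (rule ccontr)
  assume pq: "\<not> meets p q"
  note d = between_distinct[OF UXV] between_distinct[OF OVW]
  obtain w where w: "inc V w" "inc W w" using join_exists by blast
  have X: "inc X t" and O: "inc O' w" using between_inc t w UXV OVW by metis+
  have tw: "t \<noteq> w" using t w by blast
  have Vp: "\<not> inc V p" using line_unique[of V X p t] line_unique[of V O' p w] tw p X O t w d by metis
  have Up: "\<not> inc U p" using line_unique[of U X p t] Vp p X t d by metis
  have Vq: "\<not> inc V q" using line_unique[of U V q t] q t d by metis
  have "meets t p" using meetsI[of X t p] X p Vp t by metis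
  obtain v where v: "inc V v" "\<not> meets v p" using miss_exists Vp by metis
  have qv: "\<not> meets q v"
    using between_meets[OF UXV p(1) q(1) v(1)] pq v meets_sym by blast
  have Uv: "\<not> inc U v" using line_unique[of U V v t] v t d \<open>meets t p\<close> by metis
  then obtain u1 u2 where u: "limit_pair U v u1 u2" using limit_pair_exists by blast
  have pu: "meets p u1 \<or> meets p u2" using between_meets_pair[OF UXV v(1) Uv u p(1) Vp] .
  have "w \<noteq> v" using v(2) w O p Vp meetsI[of O' w p] by blast
  then have wu: "meets w u1 \<or> meets w u2" using u w v meetsI[of V w v] unfolding limit_pair_def by blast
  have u': "inc U u1" "inc U u2" "\<not> meets u1 v" "\<not> meets u2 v" using u unfolding limit_pair_def by auto
  have O\<Omega>: "\<not> meets p u \<and> (\<exists>\<Omega>. inc \<Omega> u \<and> inc \<Omega> w \<and> between O' V \<Omega>)"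
    if h: "inc U u" "\<not> meets u v" "meets w u" for u
  proof -
    obtain \<Omega> where \<Omega>: "inc \<Omega> u" "inc \<Omega> w" "u \<noteq> w" using h by (blast elim: meetsE)
    have "\<Omega> \<noteq> V" using \<Omega> h v Uv meetsI[of V u v] by blast
    have "\<not> between \<Omega> V W"
    proof
      assume b: "between \<Omega> V W"
      then have "u \<noteq> q" using \<Omega> q w Vq line_unique[of \<Omega> W q w] between_distinct[OF b] by blast
      then show False
        using not_between_if_missed[of V v \<Omega> u W q] b v \<Omega> q h qv meets_sym meetsI[of U u q] by blast
    qed
    then have 1: "between O' V \<Omega>"
      using between_cases[OF OVW O w(2) \<Omega>(2) \<open>\<Omega> \<noteq> V\<close>] by blast
    then have "\<not> meets p u" using between_meets[OF 1 v(1) p(2) \<Omega>(1)] v h meets_sym by blast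
    then show ?thesis using 1 \<Omega> by blast
  qed
  obtain u y \<Omega> where uy: "limit_pair U v u y" "\<not> meets y w" "meets p y" "\<not> meets p u" "inc \<Omega> u" "inc \<Omega> w"
    "between O' V \<Omega>"
    using O\<Omega>[OF u'(1,3)] O\<Omega>[OF u'(2,4)] pu wu u limit_pair_sym[OF u] meets_sym by metis
  have "inc U u" using uy unfolding limit_pair_def by blast
  moreover have "\<not> inc \<Omega> t"
    using line_unique[of \<Omega> V t w] uy(6,7) between_distinct[OF uy(7)] t w tw by blast
  ultimately show False
    using outer_pasch2_aux[OF UXV uy(7) t(1,2) _ p _ uy(5) uy(4) w(1) uy(6) v uy(1-3)] by blast
qed

section \<open>The two sides of a line\<close>

definition same_side :: "'l \<Rightarrow> 'p \<Rightarrow> 'p \<Rightarrow> bool" where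
  "same_side k X Y \<longleftrightarrow> \<not> inc X k \<and> \<not> inc Y k \<and> (\<forall>B. inc B k \<longrightarrow> \<not> between X B Y)"

lemma same_side_sym: "same_side k X Y \<Longrightarrow> same_side k Y X"
  unfolding same_side_def using between_sym by blast

lemma same_side_if_missed:
  "inc X l \<Longrightarrow> inc Y l \<Longrightarrow> \<not> meets l k \<Longrightarrow> l \<noteq> k \<Longrightarrow> same_side k X Y"
  unfolding same_side_def using between_inc(2) meetsI by blast

text \<open>This is transitivity in the case where the third point is joined to \<open>Y\<close> by
  a line missing \<open>k\<close>. The line \<open>k\<close> has to meet \<open>XY\<close> at a
  point \<open>O'\<close>, and the three orders of \<open>O'\<close>, \<open>X\<close>,
  \<open>Y\<close> are excluded by the hypothesis and the two outer forms of Pasch's axiom.\<close>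

lemma same_side_trans_aux:
  assumes "same_side k X Y" "between X B Z" "inc B k" "inc Y l" "inc Z l" "\<not> meets l k" "Y \<noteq> Z"
  shows False
proof -
  note d = between_distinct[OF assms(2)]
  obtain t where t: "inc X t" "inc B t" "inc Z t" using between_line assms by blast
  have "\<not> inc X k" "\<not> inc Y k" using assms unfolding same_side_def by auto
  then have "\<not> inc Z k" using line_unique[of B Z t k] t assms d by blast
  obtain s where s: "inc X s" "inc Y s" using join_exists by blast
  show False
  proof (cases "inc Y t")
    case True
    then have "l = t" using assms t line_unique[of Y Z l t] by blast
    then show False using assms t meetsI[of B t k] \<open>\<not> inc X k\<close> by blast
  next
    case False
    then have "s \<noteq> l" using line_unique[of X Z l t] s assms t d by blast
    have "meets k s"
      using between_meets[OF assms(2,3) s(1) assms(5)] meetsI[of Y s l] s assms \<open>s \<noteq> l\<close> meets_sym by blast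
    then obtain O' where O: "inc O' k" "inc O' s" by (blast elim: meetsE)
    have dO: "O' \<noteq> X" "O' \<noteq> Y" "X \<noteq> Y" using O \<open>\<not> inc X k\<close> \<open>\<not> inc Y k\<close> False t by blast+
    have "\<not> between X O' Y" using assms O unfolding same_side_def by blast
    moreover have "\<not> between X Y O'"
    proof
      assume "between X Y O'"
      moreover have "\<not> inc X l" using \<open>s \<noteq> l\<close> line_unique[of X Y s l] s assms dO by blast
      ultimately show False
        using outer_pasch1[OF assms(2), of Y O' k l] assms O \<open>\<not> inc Z k\<close> meets_sym by blast
    qed
    moreover have "\<not> between O' X Y"
      using outer_pasch2[OF between_sym[OF assms(2)], of O' Y t k l] t False assms O meets_sym by blast
    ultimately show False using trichotomy[of O' X Y s] O s dO between_sym by metis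
  qed
qed

text \<open>If \<open>XY\<close> meets \<open>k\<close>, then \<open>two_step_path\<close> provides
  a detour from \<open>X\<close> over \<open>T\<close> to \<open>Y\<close> along lines that miss
  \<open>k\<close>, and the previous lemma applies to each half of it.\<close>

lemma same_side_trans:
  assumes "same_side k X Y" "same_side k Y Z" shows "same_side k X Z"
proof -
  have XYZ: "\<not> inc X k" "\<not> inc Y k" "\<not> inc Z k" using assms unfolding same_side_def by auto
  have False if B: "inc B k" "between X B Z" for B
  proof -
    note d = between_distinct[OF B(2)]
    obtain t where t: "inc X t" "inc B t" "inc Z t" using between_line B by blast
    have "Y \<noteq> X" "Y \<noteq> Z" using assms B unfolding same_side_def by blast+
    obtain s where s: "inc X s" "inc Y s" using join_exists by blast
    show False
    proof (cases "meets s k")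
      case False
      then show False
        using same_side_trans_aux[OF same_side_sym[OF assms(2)] between_sym[OF B(2)] B(1) s(2,1) False]
          \<open>Y \<noteq> X\<close> by blast
    next
      case True
      then obtain O' where O: "inc O' k" "inc O' s" by (blast elim: meetsE)
      have dO: "O' \<noteq> X" "O' \<noteq> Y" using O XYZ by blast+
      have "\<not> between X O' Y" using assms O unfolding same_side_def by blast
      then have "between O' X Y \<or> between O' Y X"
        using trichotomy[of O' X Y s] O s dO \<open>Y \<noteq> X\<close> between_sym by metis
      then obtain x y where xy: "inc X x" "inc Y y" "\<not> meets x k" "\<not> meets y k" "meets x y"
        using two_step_path[of O' X Y k] two_step_path[of O' Y X k] O XYZ meets_sym by metis
      then obtain T where T: "inc T x" "inc T y" by (blast elim: meetsE)
      have "T \<noteq> X"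
      proof
        assume "T = X"
        then have "y = s" using line_unique[of X Y y s] T s xy \<open>Y \<noteq> X\<close> by blast
        then show False using xy True by blast
      qed
      have "x \<noteq> k" "y \<noteq> k" using xy XYZ by blast+
      have XT: "same_side k X T" "same_side k T Y"
        using same_side_if_missed xy T \<open>x \<noteq> k\<close> \<open>y \<noteq> k\<close> by blast+
      have "\<not> same_side k T Z"
        using same_side_trans_aux[OF same_side_sym between_sym[OF B(2)] B(1) T(1) xy(1) xy(3) \<open>T \<noteq> X\<close>] by blast
      then obtain C where C: "inc C k" "between T C Z"
        using XT XYZ unfolding same_side_def by blast
      have "T \<noteq> Y" using C assms unfolding same_side_def by blast
      then show False
        using same_side_trans_aux[OF same_side_sym[OF assms(2)] between_sym[OF C(2)] C(1) xy(2) T(2) xy(4)] by blast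
    qed
  qed
  then show ?thesis using XYZ unfolding same_side_def by blast
qed

lemma same_sideD: "same_side k X Y \<Longrightarrow> inc B k \<Longrightarrow> \<not> between X B Y"
  "same_side k X Y \<Longrightarrow> \<not> inc X k" "same_side k X Y \<Longrightarrow> \<not> inc Y k"
  unfolding same_side_def by blast+

text \<open>A line other than \<open>k\<close> has at most one point on \<open>k\<close>, so only
  \<open>B\<close> has to be tested.\<close>

lemma same_sideI:
  assumes "inc X l" "inc Y l" "inc B l" "inc B k" "\<not> inc X k" "Y \<noteq> B" "\<not> between X B Y"
  shows "same_side k X Y"
proof -
  have "C = B" if "inc C l" "inc C k" for C using line_unique[of B C l k] assms that by blast
  then show ?thesis using assms between_inc(2) unfolding same_side_def by blast
qed

lemma same_side_between:
  assumes "inc B k" "between B X Y" "\<not> inc X k"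
  shows "same_side k X Y"
proof -
  obtain l where "inc B l" "inc X l" "inc Y l" using between_line assms by blast
  then show ?thesis
    using same_sideI[of X l Y B k] assms between_distinct[OF assms(2)] between_unique by blast
qed

lemma same_side_convex:
  assumes "same_side k X Y" "between X Z Y" shows "same_side k X Z" "same_side k Z Y"
proof -
  obtain l where l: "inc X l" "inc Z l" "inc Y l" using between_line assms by blast
  have "\<not> inc Z k" using assms same_sideD by blast
  then show "same_side k X Z" "same_side k Z Y"
    using assms between_trans2 between_sym unfolding same_side_def by blast+
qed

lemma not_same_sideD:
  assumes "\<not> same_side k X Y" "\<not> inc X k" "\<not> inc Y k"
  shows "\<exists>B. inc B k \<and> between X B Y"
  using assms unfolding same_side_def by blast

text \<open>Both \<open>P\<close> and \<open>S\<close> are on the side of \<open>s\<close> that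
  contains \<open>X\<close>, whereas \<open>Q\<close> is on \<open>s\<close> itself.\<close>

lemma other_side_aux:
  assumes "between X P Y" "between X S Z" "inc Y s" "inc Z s" "inc Q s" "\<not> inc X s"
  shows "\<not> between P Q S"
proof -
  obtain l where l: "inc X l" "inc P l" "inc Y l" using between_line assms by blast
  obtain l' where l': "inc X l'" "inc S l'" "inc Z l'" using between_line assms by blast
  have "same_side s X P" "same_side s X S"
    using same_sideI[of X l P Y s] same_sideI[of X l' S Z s] assms l l' between_distinct[OF assms(1)]
      between_distinct[OF assms(2)] between_unique' by blast+
  then show ?thesis using same_side_trans same_side_sym same_sideD(1) assms by blast
qed

text \<open>This is Pasch's axiom. If \<open>k\<close> cut all three sides of a triangle, the three
  points of intersection would lie on \<open>k\<close> with none between the other two. Collinear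
  \<open>X\<close>, \<open>Y\<close>, \<open>Z\<close> are settled by their order.\<close>

lemma two_sides:
  assumes "\<not> same_side k X Y" "\<not> same_side k Y Z" "\<not> inc X k" "\<not> inc Y k" "\<not> inc Z k"
  shows "same_side k X Z"
proof (rule ccontr)
  assume n: "\<not> same_side k X Z"
  obtain P Q S where B: "inc P k" "between X P Y" "inc Q k" "between Y Q Z" "inc S k" "between X S Z"
    using assms n not_same_sideD by metis
  note d = between_distinct[OF B(2)] between_distinct[OF B(4)] between_distinct[OF B(6)]
  obtain l1 where l1: "inc X l1" "inc P l1" "inc Y l1" using between_line B by blast
  obtain l2 where l2: "inc Y l2" "inc Q l2" "inc Z l2" using between_line B by blast
  obtain l3 where l3: "inc X l3" "inc S l3" "inc Z l3" using between_line B by blast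
  show False
  proof (cases "inc X l2")
    case True
    then have "l1 = l2" "l3 = l2" using line_unique[of X Y l1 l2] line_unique[of X Z l3 l2] l1 l2 l3 d by blast+
    then have "P = Q" "S = Q"
      using line_unique[of P Q l2 k] line_unique[of S Q l2 k] l1 l2 l3 B assms by blast+
    moreover have "between X Y Z \<or> between Y X Z \<or> between X Z Y"
      using trichotomy[of X Y Z l2] True l2 d by blast
    ultimately show False
      using B between_trans1 between_unique between_unique' between_sym by metis
  next
    case False
    then have l: "\<not> inc Y l3" "\<not> inc Z l1" "\<not> inc X l2" "l1 \<noteq> l2" "l1 \<noteq> l3" "l2 \<noteq> l3"
      using line_unique[of X Z l3 l2] line_unique[of X Y l1 l2] line_unique[of Y Z l3 l2]
        line_unique[of Y Z l1 l2] l1 l2 l3 d by blast+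
    have "P \<noteq> Q" using line_unique[of P Y l1 l2] l1 l2 l d by blast
    have "P \<noteq> S" using line_unique[of P X l1 l3] l1 l3 l d by blast
    have "Q \<noteq> S" using line_unique[of Q Z l2 l3] l2 l3 l d by blast
    have "\<not> between P Q S" "\<not> between P S Q" "\<not> between Q P S"
      using other_side_aux[OF B(2,6) l2(1,3,2) l(3)]
        other_side_aux[OF between_sym[OF B(2)] B(4) l3(1,3,2) l(1)]
        other_side_aux[OF between_sym[OF B(4)] between_sym[OF B(6)] l1(3,1,2) l(2)] by blast+
    then show False
      using trichotomy[of P Q S k] B \<open>P \<noteq> Q\<close> \<open>P \<noteq> S\<close> \<open>Q \<noteq> S\<close> by blast
  qed
qed

text \<open>On another line through \<open>D\<close> some \<open>Y\<close> is between
  \<open>D\<close> and a point \<open>P\<close>. A line through \<open>Y\<close> that misses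
  \<open>PA\<close> separates \<open>D\<close> from \<open>P\<close>, hence also from
  \<open>A\<close>.\<close>

lemma between_dense:
  assumes "A \<noteq> D" shows "\<exists>X. between D X A"
proof -
  obtain l where l: "inc A l" "inc D l" using join_exists by blast
  obtain d where d: "inc D d" "d \<noteq> l" using other_line l by blast
  obtain Y P where Y: "inc Y d" "inc P d" "between D Y P" using between_from d by blast
  note dd = between_distinct[OF Y(3)]
  have P: "\<not> inc P l" using line_unique[of D P d l] Y d l dd by blast
  obtain g where g: "inc P g" "inc A g" using join_exists by blast
  have A: "\<not> inc A d" using line_unique[of D A d l] l d assms by blast
  have D: "\<not> inc D g" using line_unique[of D A g l] g l P assms by blast
  have Yg: "\<not> inc Y g" using line_unique[of P Y g d] Y g dd A by blast
  then obtain y where y: "inc Y y" "\<not> meets y g" using miss_exists by blast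
  have "same_side y P A" using same_side_if_missed[of P g A y] g y Yg meets_sym by blast
  moreover have "\<not> same_side y D P" using Y y same_sideD by blast
  moreover have "\<not> inc D y"
  proof
    assume "inc D y"
    then have "y = d" using line_unique[of D Y y d] d Y y dd by blast
    then show False using y Y g A meetsI[of P d g] by blast
  qed
  ultimately show ?thesis using not_same_sideD same_side_trans same_side_sym same_sideD by metis
qed

section \<open>Crossbar theorem\<close>

lemma crossbar_aux:
  assumes "same_side m N X" "same_side n M X" "inc P m" "inc M m" "inc P n" "inc N n"
    "inc P x" "inc X x" "same_side x M N" "inc M e" "inc N e" "inc T e" "inc T x" "between T M N"
  shows False
proof -
  note d = between_distinct[OF assms(14)]
  have "M \<noteq> P" "N \<noteq> P" "X \<noteq> P" using assms same_sideD by blast+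
  have "e \<noteq> m" "e \<noteq> n" using assms same_sideD by blast+
  have "\<not> inc T n" using line_unique[of T N e n] assms d \<open>e \<noteq> n\<close> by blast
  have "\<not> inc T m" using line_unique[of T M e m] assms d \<open>e \<noteq> m\<close> by blast
  have "same_side n M T"
    using same_side_between[of N n M T] assms between_sym same_sideD by blast
  then have "same_side n T X" using assms same_side_trans same_side_sym by blast
  then have "\<not> between T P X" using same_sideD assms by blast
  then have "T = X \<or> same_side m T X"
    using same_sideI[of T x X P m] assms \<open>\<not> inc T m\<close> \<open>X \<noteq> P\<close> by blast
  then have "same_side m T N" using assms same_side_trans same_side_sym by blast
  then show False using assms same_sideD by blast
qed

text \<open>Here \<open>MN\<close> misses \<open>x\<close>. The line \<open>MX\<close> separates
  \<open>P\<close> from \<open>Z\<close>, hence from \<open>N\<close>, and so meets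
  \<open>PN\<close> at a point \<open>B\<close>. The order on \<open>MX\<close> turns out to be
  \<open>M\<close>, \<open>X\<close>, \<open>B\<close>, so \<open>x\<close> separates
  \<open>M\<close> from \<open>B\<close> and therefore from \<open>N\<close>.\<close>

lemma crossbar_aux2:
  assumes "same_side m N X" "same_side n M X" "inc P m" "inc M m" "inc P n" "inc N n"
    "inc P x" "inc X x" "same_side x M N" "inc M e" "inc N e" "\<not> meets e x"
    "between M Z N" "inc P z" "inc Z z" "between M W X" "inc W z"
  shows False
proof -
  note d = between_distinct[OF assms(13)] between_distinct[OF assms(16)]
  have Ze: "inc Z e" using between_inc assms by metis
  have "M \<noteq> P" "N \<noteq> P" "X \<noteq> P" using assms same_sideD by blast+
  have "e \<noteq> m" "e \<noteq> n" "e \<noteq> x" using assms same_sideD by blast+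
  have Pe: "\<not> inc P e" using meetsI[of P e x] assms \<open>e \<noteq> x\<close> by blast
  obtain \<alpha> where \<alpha>: "inc M \<alpha>" "inc W \<alpha>" "inc X \<alpha>" using between_line assms by blast
  have Xe: "\<not> inc X e" using meetsI[of X e x] assms \<open>e \<noteq> x\<close> by blast
  have We: "\<not> inc W e" using line_unique[of M W e \<alpha>] \<alpha> assms d Xe by blast
  have Zm: "\<not> inc Z m" using line_unique[of M Z e m] assms Ze d \<open>e \<noteq> m\<close> by blast
  have "\<alpha> \<noteq> m" using \<alpha> assms same_sideD by blast
  have Wm: "\<not> inc W m" using line_unique[of M W \<alpha> m] assms \<alpha> d \<open>\<alpha> \<noteq> m\<close> by blast
  have "same_side m Z N" "same_side m W X"
    using same_side_between[of M m] assms Zm Wm by blast+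
  then have mZW: "same_side m Z W" using assms same_side_trans same_side_sym by blast
  have "same_side e P X" using same_side_if_missed[of P x X e] assms \<open>e \<noteq> x\<close> meets_sym by blast
  moreover have "same_side e W X" using same_side_between[of M e W X] assms We by blast
  ultimately have "same_side e P W" using same_side_trans same_side_sym by blast
  then have 1: "\<not> between P Z W" using same_sideD Ze by blast
  have 2: "\<not> between Z P W" using mZW same_sideD assms by blast
  have "P \<noteq> Z" "P \<noteq> W" "Z \<noteq> W" using Pe Ze We Wm assms by blast+
  then have 3: "between P W Z" using trichotomy[of P W Z z] 1 2 assms between_sym by metis
  have "e \<noteq> \<alpha>" using Xe \<alpha> by blast
  then have Z\<alpha>: "\<not> inc Z \<alpha>" using line_unique[of M Z e \<alpha>] \<alpha> assms Ze d by blast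
  then have N\<alpha>: "same_side \<alpha> Z N" using same_side_between[of M \<alpha> Z N] assms \<alpha> by blast
  have P\<alpha>: "\<not> inc P \<alpha>" using line_unique[of M P \<alpha> m] \<alpha> assms \<open>\<alpha> \<noteq> m\<close> \<open>M \<noteq> P\<close> by blast
  have "\<not> same_side \<alpha> P Z" using 3 \<alpha> same_sideD by blast
  then have "\<not> same_side \<alpha> P N" using N\<alpha> same_side_trans same_side_sym by blast
  then obtain B where B: "inc B \<alpha>" "between P B N" using not_same_sideD P\<alpha> N\<alpha> same_sideD by blast
  note dB = between_distinct[OF B(2)]
  have Bn: "inc B n" using between_inc B assms by metis
  have "B \<noteq> X" "B \<noteq> M" using Bn assms same_sideD by blast+
  have Bm: "\<not> inc B m" using line_unique[of P B n m] Bn assms dB same_sideD by blast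
  have Bx: "\<not> inc B x" using line_unique[of P B n x] Bn assms dB same_sideD by blast
  have "\<not> between M B X" using Bn assms same_sideD by blast
  moreover have "same_side m B N" using same_side_between B Bm assms by blast
  then have "same_side m B X" using assms same_side_trans by blast
  then have "\<not> between B M X" using assms same_sideD by blast
  ultimately have MXB: "between M X B"
    using trichotomy[of M X B \<alpha>] \<alpha> B \<open>B \<noteq> X\<close> \<open>B \<noteq> M\<close> d between_sym by metis
  have "same_side x B N" using same_side_between B Bx assms by blast
  then have "same_side x M B" using assms same_side_trans same_side_sym by blast
  then show False using MXB assms same_sideD by blast
qed

text \<open>The point \<open>X\<close> is inside the angle at \<open>P\<close> whose sides go
  through \<open>M\<close> and \<open>N\<close>, so the line \<open>PX\<close> separates these two.
  If \<open>MN\<close> missed \<open>x\<close>, a line from \<open>P\<close> to a point between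
  \<open>M\<close> and \<open>N\<close> would cut one of the segments \<open>MX\<close> and
  \<open>NX\<close>, and the two cases are mirror images.\<close>

lemma crossbar:
  assumes "same_side m N X" "same_side n M X" "inc P m" "inc M m" "inc P n" "inc N n"
    "inc P x" "inc X x"
  shows "\<not> same_side x M N"
proof
  assume s: "same_side x M N"
  obtain e where e: "inc M e" "inc N e" using join_exists by blast
  have "M \<noteq> N" using assms same_sideD by blast
  show False
  proof (cases "meets e x")
    case True
    then obtain T where T: "inc T e" "inc T x" by (blast elim: meetsE)
    have "T \<noteq> M" "T \<noteq> N" using T s same_sideD by blast+
    moreover have "\<not> between M T N" using s T same_sideD by blast
    ultimately consider "between T M N" | "between T N M"
      using trichotomy[of T M N e] T e \<open>M \<noteq> N\<close> by blast
    then show False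
      using crossbar_aux[OF assms s e T] crossbar_aux[OF assms(2,1,5,6,3,4,7,8) same_side_sym[OF s] e(2,1) T]
      by cases blast+
  next
    case False
    obtain Z where Z: "between M Z N" using between_dense \<open>M \<noteq> N\<close> by metis
    obtain z where z: "inc P z" "inc Z z" using join_exists by blast
    have Ze: "inc Z e" using between_inc Z e by metis
    have "e \<noteq> x" using e s same_sideD by blast
    have "Z \<noteq> P" using meetsI[of Z e x] Ze assms \<open>e \<noteq> x\<close> False by blast
    have "X \<noteq> P" using assms same_sideD by blast
    have Xz: "\<not> inc X z"
    proof
      assume "inc X z"
      then have "z = x" using line_unique[of P X z x] assms z \<open>X \<noteq> P\<close> by blast
      then show False using meetsI[of Z e x] Ze z \<open>e \<noteq> x\<close> False by blast
    qed
    have "e \<noteq> m" "e \<noteq> n" using assms e same_sideD by blast+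
    then have "z \<noteq> m" "z \<noteq> n" using line_unique[of Z M z e] line_unique[of Z N z e] z Ze e assms
        between_distinct[OF Z] by blast+
    moreover have "M \<noteq> P" "N \<noteq> P" using assms same_sideD by blast+
    ultimately have Mz: "\<not> inc M z" "\<not> inc N z"
      using line_unique[of P M z m] line_unique[of P N z n] z assms by blast+
    have "\<not> same_side z M N" using Z z same_sideD by blast
    then have "\<not> same_side z M X \<or> \<not> same_side z N X" using same_side_trans same_side_sym by blast
    then consider W where "inc W z" "between M W X" | W where "inc W z" "between N W X"
      using not_same_sideD Mz Xz by blast
    then show False
      using crossbar_aux2[OF assms s e False Z z]
        crossbar_aux2[OF assms(2,1,5,6,3,4,7,8) same_side_sym[OF s] e(2,1) False between_sym[OF Z] z]
      by cases blast+
  qed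
qed

subsection \<open>Limiting and asymptotic rays\<close>

lemma limit_pairD:
  assumes "limit_pair P l m n"
  shows "\<not> inc P l" "m \<noteq> n" "inc P m" "inc P n" "\<not> meets m l" "\<not> meets n l" "\<not> meets l m" "\<not> meets l n"
    "m \<noteq> l" "n \<noteq> l" "meets k l \<Longrightarrow> meets k m \<or> meets k n"
  using assms meets_sym unfolding limit_pair_def by blast+

text \<open>A line \<open>x\<close> through \<open>Q\<close> that misses \<open>m\<close> can be
  chosen to meet \<open>k\<close>. It crosses \<open>l\<close> at \<open>Q\<close>, so A5 makes it
  meet \<open>n\<close> too. Since \<open>k\<close> and \<open>n\<close> miss \<open>l\<close>, both
  meeting points are on one side of \<open>l\<close>, and this fixes their order on
  \<open>x\<close>.\<close>

lemma limit_pair_meets_inside_aux: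
  assumes "limit_pair P l m n" "inc Q l" "same_side m K Q" "same_side n K Q" "inc P k" "inc K k"
    "\<not> meets k l"
  shows "\<exists>x K1 N. inc Q x \<and> inc K1 x \<and> inc N x \<and> inc K1 k \<and> inc N n \<and> \<not> meets x m \<and> between N K1 Q \<and>
    same_side m K1 Q \<and> x \<noteq> m"
proof -
  note p = limit_pairD[OF assms(1)]
  have ne: "k \<noteq> m" "k \<noteq> n" "k \<noteq> l" using assms p same_sideD by blast+
  have "\<not> inc Q m" using assms same_sideD by blast
  moreover have "meets k m" using meetsI p assms ne by blast
  ultimately obtain x where x: "inc Q x" "\<not> meets x m" "meets k x"
    using miss_meeting_exists by blast
  have "x \<noteq> l" using x assms by blast
  then have "meets x l" using x assms meetsI by blast
  then have "meets x n" using p x by blast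
  then obtain N where N: "inc N x" "inc N n" by (blast elim: meetsE)
  obtain K1 where K1: "inc K1 k" "inc K1 x" using x by (blast elim: meetsE)
  have "x \<noteq> m" using x \<open>\<not> inc Q m\<close> by blast
  then have mK: "same_side m K1 Q" using same_side_if_missed K1 x by blast
  have PK: "K1 \<noteq> P" "K \<noteq> P" using mK assms p same_sideD by blast+
  have "\<not> between K P K1"
    using same_side_trans[OF assms(3) same_side_sym[OF mK]] same_sideD p by blast
  then have "same_side n K K1"
    using same_sideI[of K k K1 P n] assms K1 p PK same_sideD by blast
  then have nK: "same_side n K1 Q" using assms same_side_trans same_side_sym by blast
  have "same_side l K1 P" "same_side l P N"
    using same_side_if_missed[of K1 k P l] same_side_if_missed[of P n N l] assms K1 N p ne by blast+
  then have lK: "same_side l K1 N" using same_side_trans by blast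
  have "K1 \<noteq> N" "K1 \<noteq> Q" "N \<noteq> Q" using lK nK N assms same_sideD by blast+
  moreover have "\<not> between K1 N Q" "\<not> between K1 Q N"
    using lK nK N assms same_sideD by blast+
  ultimately have "between N K1 Q"
    using trichotomy[of N K1 Q x] N K1 x between_sym by blast
  then show ?thesis using x K1 N mK \<open>x \<noteq> m\<close> by blast
qed

text \<open>So the two lines of axiom A5 are limiting parallels.\<close>

lemma limit_pair_meets_inside:
  assumes "limit_pair P l m n" "inc Q l" "same_side m K Q" "same_side n K Q" "inc P k" "inc K k"
  shows "meets k l"
proof (rule ccontr)
  assume n: "\<not> meets k l"
  obtain x1 K1 N where x1: "inc Q x1" "inc K1 x1" "inc N x1" "inc K1 k" "inc N n" "\<not> meets x1 m"
    "between N K1 Q" "same_side m K1 Q" "x1 \<noteq> m"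
    using limit_pair_meets_inside_aux[OF assms n] by blast
  obtain x2 K2 M where x2: "inc Q x2" "inc K2 x2" "inc M x2" "inc K2 k" "inc M m" "\<not> meets x2 n"
    "between M K2 Q" "same_side n K2 Q" "x2 \<noteq> n"
    using limit_pair_meets_inside_aux[OF limit_pair_sym[OF assms(1)] assms(2,4,3,5,6) n] by blast
  note p = limit_pairD[OF assms(1)]
  note d = between_distinct[OF x1(7)] between_distinct[OF x2(7)]
  have ne: "k \<noteq> m" "k \<noteq> n" using assms p same_sideD by blast+
  have Q: "\<not> inc Q m" "\<not> inc Q n" "\<not> inc Q k" using assms n same_sideD meetsI[of Q k l] p by metis+
  have "x1 \<noteq> x2" using x1 x2 meetsI[of N x1 n] Q by blast
  then have K12: "K1 \<noteq> K2" using line_unique[of Q K1 x1 x2] x1 x2 d by blast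
  have PK: "K1 \<noteq> P" "K2 \<noteq> P" using x1 x2 p same_sideD by blast+
  have "same_side m K2 Q"
    using same_side_between[of M m K2 Q] x2 line_unique[of P K2 k m] PK assms p ne by blast
  then have "same_side m K1 K2" using x1 same_side_trans same_side_sym by blast
  then have 1: "\<not> between K1 P K2" using same_sideD p by blast
  have Mx: "\<not> inc M x1" "\<not> inc N x2"
    using x1 x2 meetsI[of M x1 m] meetsI[of N x2 n] by blast+
  have "same_side x1 P M" using same_side_if_missed[of P m M x1] p x1 x2 meets_sym by blast
  moreover have "same_side x1 K2 M"
    using same_side_between[of Q x1 K2 M] x1 x2 between_sym line_unique[of Q K2 x1 x2] \<open>x1 \<noteq> x2\<close> d by blast
  ultimately have "same_side x1 P K2" using same_side_trans same_side_sym by blast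
  then have 2: "\<not> between P K1 K2" using x1 same_sideD by blast
  have "same_side x2 P N" using same_side_if_missed[of P n N x2] p x1 x2 meets_sym by blast
  moreover have "same_side x2 K1 N"
    using same_side_between[of Q x2 K1 N] x1 x2 between_sym line_unique[of Q K1 x1 x2] \<open>x1 \<noteq> x2\<close> d by blast
  ultimately have "same_side x2 P K1" using same_side_trans same_side_sym by blast
  then have 3: "\<not> between P K2 K1" using x2 same_sideD by blast
  show False using trichotomy[of P K1 K2 k] 1 2 3 PK K12 x1 x2 assms by blast
qed

text \<open>A line through \<open>Q\<close> that misses \<open>n\<close> and is not \<open>l\<close>
  crosses \<open>l\<close>, so it must meet \<open>m\<close>; the point where it does is on the side
  of \<open>n\<close> that contains \<open>Q\<close>.\<close>

lemma limit_pair_rays: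
  assumes "limit_pair P l m n" "inc Q l"
  shows "\<exists>M. inc M m \<and> same_side n M Q"
proof -
  note p = limit_pairD[OF assms(1)]
  have Q: "\<not> inc Q n" using meetsI[of Q n l] assms p by blast
  obtain x where x: "inc Q x" "\<not> meets x n" "x \<noteq> l" using miss_exists Q by metis
  then have "meets x m" using p(11)[of x] meetsI assms by blast
  then obtain M where M: "inc M x" "inc M m" by (blast elim: meetsE)
  moreover have "x \<noteq> n" using x Q by blast
  ultimately show ?thesis using same_side_if_missed x by blast
qed

text \<open>A point \<open>K\<close> between \<open>M\<close> and \<open>B\<close> is inside the
  angle at \<open>P\<close>, so \<open>PK\<close> meets \<open>l\<close> at some \<open>C\<close>.
  This \<open>C\<close> is on the same side of \<open>x\<close> as \<open>M\<close>, which is not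
  the side of \<open>A\<close>.\<close>

lemma between_extend_aux:
  assumes "limit_pair P l m n" "inc B l" "inc A l" "A \<noteq> B" "inc P x" "inc B x"
    "inc M m" "same_side n M B" "\<not> same_side x A M" "\<not> inc M x"
  shows "\<exists>C. between A B C"
proof -
  note p = limit_pairD[OF assms(1)]
  have lx: "l \<noteq> x" using assms p by blast
  have Bm: "\<not> inc B m" using meetsI[of B m l] assms p by blast
  then obtain K where K: "between M K B" using between_dense assms by metis
  note dK = between_distinct[OF K]
  obtain e where e: "inc M e" "inc K e" "inc B e" using between_line K by blast
  have Km: "\<not> inc K m" using line_unique[of M K e m] e assms dK Bm by blast
  then have mK: "same_side m K B" using same_side_between K assms by blast
  have nK: "same_side n K B" using same_side_convex K assms by blast
  obtain k where k: "inc P k" "inc K k" using join_exists by blast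
  then have "meets k l" using limit_pair_meets_inside assms mK nK by blast
  then obtain C where C: "inc C k" "inc C l" by (blast elim: meetsE)
  have Kx: "\<not> inc K x" using line_unique[of B K e x] e assms dK by blast
  have xK: "same_side x K M" using same_side_between[of B x K M] K between_sym assms Kx by blast
  have "same_side m C B" using same_side_if_missed[of C l B m] C assms p by blast
  then have "same_side m K C" using mK same_side_trans same_side_sym by blast
  then have "\<not> between K P C" using same_sideD p by blast
  moreover have "C \<noteq> P" using C p by blast
  ultimately have xC: "same_side x K C" using same_sideI[of K k C P x] k C assms Kx by blast
  then have "\<not> same_side x A C" using xK assms same_side_trans same_side_sym by blast
  moreover have "\<not> inc A x" using line_unique[of A B l x] assms lx by blast
  ultimately obtain B' where B': "inc B' x" "between A B' C" using not_same_sideD xC same_sideD by blast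
  then have "inc B' l" using between_inc assms C by metis
  then have "B' = B" using line_unique[of B' B l x] B' assms lx by blast
  then show ?thesis using B' by blast
qed

text \<open>By the crossbar theorem the two limiting rays from \<open>P\<close> are on different
  sides of \<open>PB\<close>, so one of them is not on the side of \<open>A\<close>.\<close>

lemma between_extend:
  assumes "A \<noteq> B" shows "\<exists>C. between A B C"
proof -
  obtain l where l: "inc A l" "inc B l" using join_exists by blast
  obtain P where P: "\<not> inc P l" using off_line by blast
  obtain m n where mn: "limit_pair P l m n" using limit_pair_exists P by blast
  note p = limit_pairD[OF mn]
  obtain M where M: "inc M m" "same_side n M B" using limit_pair_rays mn l by blast
  obtain N where N: "inc N n" "same_side m N B" using limit_pair_rays limit_pair_sym mn l by blast
  obtain x where x: "inc P x" "inc B x" using join_exists by blast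
  have opp: "\<not> same_side x M N" using crossbar[OF N(2) M(2) p(3) M(1) p(4) N(1) x] .
  have B: "\<not> inc B m" "\<not> inc B n" using M N same_sideD by blast+
  have "M \<noteq> P" "N \<noteq> P" using M N p same_sideD by blast+
  then have "\<not> inc M x" "\<not> inc N x"
    using line_unique[of P M m x] line_unique[of P N n x] M N B p x by blast+
  then show ?thesis
    using between_extend_aux[OF mn l(2,1) assms x M] between_extend_aux[OF limit_pair_sym[OF mn] l(2,1) assms x N]
      opp same_side_trans same_side_sym by blast
qed

text \<open>Otherwise \<open>a\<close> cuts \<open>A'B\<close> at a point \<open>T\<close> on the
  side of \<open>x\<close> that contains \<open>A\<close>, and then \<open>a'\<close> separates
  \<open>A\<close> from \<open>T\<close>. But \<open>a'\<close> meets \<open>a\<close> only at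
  \<open>P\<close>, which is on \<open>x\<close>. So of two rays on one side of \<open>PB\<close>,
  one is inside the angle that the other forms with \<open>PB\<close>.\<close>

lemma ray_trichotomy:
  assumes "same_side x A A'" "inc P a" "inc A a" "inc P a'" "inc A' a'" "a \<noteq> a'" "inc P x" "inc B x" "B \<noteq> P"
  shows "same_side a A' B \<or> same_side a' A B"
proof (rule ccontr)
  assume n: "\<not> ?thesis"
  have AP: "A \<noteq> P" "A' \<noteq> P" using assms same_sideD by blast+
  have "\<not> inc B a" "\<not> inc B a'"
    using line_unique[of B P a x] line_unique[of B P a' x] assms same_sideD by blast+
  moreover have Aa: "\<not> inc A' a" "\<not> inc A a'"
    using line_unique[of P A' a a'] line_unique[of P A a a'] assms AP by blast+
  ultimately obtain T where T: "inc T a" "between A' T B" using n not_same_sideD by blast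
  note d = between_distinct[OF T(2)]
  have Tx: "\<not> inc T x"
    using between_inc(3)[OF T(2), of x] assms(1,8) same_sideD(3) by blast
  then have "same_side x T A'" using same_side_between between_sym T assms by blast
  then have xT: "same_side x T A" using assms same_side_trans same_side_sym by blast
  have "T \<noteq> P" using Tx assms by blast
  then have Ta: "\<not> inc T a'" using line_unique[of P T a a'] T assms by blast
  then have "same_side a' T B" using same_side_between T assms by blast
  then have "\<not> same_side a' A T" using n same_side_trans by blast
  then obtain B' where B': "inc B' a'" "between A B' T" using not_same_sideD Aa Ta by blast
  have "inc B' a" using between_inc B' assms T by metis
  then have "B' = P" using line_unique[of B' P a a'] B' assms by blast
  then show False using B' xT same_sideD assms same_side_sym by blast
qed

text \<open>The line \<open>a\<close> is one of the two lines of A5; the condition on the other one,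
  \<open>n\<close>, selects the ray of \<open>a\<close> that runs along \<open>b\<close>.\<close>

definition limiting :: "'p \<Rightarrow> 'p \<Rightarrow> 'l \<Rightarrow> 'l \<Rightarrow> bool" where
  "limiting P A a b \<longleftrightarrow> inc A a \<and> (\<exists>n. limit_pair P b a n \<and> (\<forall>B. inc B b \<longrightarrow> same_side n A B))"

lemma limitingD:
  assumes "limiting P A a b"
  shows "inc A a" "inc P a" "A \<noteq> P" "\<not> inc P b" "\<not> meets a b" "\<not> meets b a" "a \<noteq> b"
proof -
  obtain n where n: "limit_pair P b a n" "\<forall>B. inc B b \<longrightarrow> same_side n A B" "inc A a"
    using assms unfolding limiting_def by blast
  note p = limit_pairD[OF n(1)]
  obtain B where "inc B b" using A2 by blast
  then have "\<not> inc A n" using n same_sideD by blast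
  then show "inc A a" "inc P a" "A \<noteq> P" "\<not> inc P b" "\<not> meets a b" "\<not> meets b a" "a \<noteq> b"
    using n p by blast+
qed

text \<open>The angle given is the one between \<open>PA\<close> and \<open>PB\<close>, while
  \<open>limit_pair_meets_inside\<close> speaks of the one between \<open>a\<close> and
  \<open>n\<close>. The former is contained in the latter: by the crossbar theorem the ray of
  \<open>n\<close> on the side of \<open>a\<close> that contains \<open>b\<close> is separated from
  \<open>A\<close> by \<open>x\<close>.\<close>

lemma limiting_meets:
  assumes "limiting P A a b" "inc B b" "same_side a K B" "inc P x" "inc B x" "same_side x K A"
    "inc P k" "inc K k"
  shows "meets k b"
proof -
  obtain n where n: "limit_pair P b a n" "\<forall>B. inc B b \<longrightarrow> same_side n A B" "inc A a"
    using assms unfolding limiting_def by blast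
  note p = limit_pairD[OF n(1)]
  have nAB: "same_side n A B" using n assms by blast
  have Kn: "\<not> inc K n"
    using crossbar[OF assms(3) nAB p(3) n(3) p(4) _ assms(4,5)] assms(6) same_side_sym by blast
  have "same_side n K B"
  proof (rule ccontr)
    assume "\<not> same_side n K B"
    then have "\<not> same_side n K A" using nAB same_side_trans by blast
    then obtain T where T: "inc T n" "between K T A" using not_same_sideD Kn nAB same_sideD by blast
    have xT: "same_side x T A" using same_side_convex assms T by blast
    then have "T \<noteq> P" using assms same_sideD by blast
    then have "\<not> inc T a" using line_unique[of P T a n] T p by blast
    then have "same_side a T K" using same_side_between between_sym T n by blast
    then have "same_side a T B" using assms same_side_trans by blast
    then show False
      using crossbar[OF _ nAB p(3) n(3) p(4) T(1) assms(4,5)] xT same_side_sym by blast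
  qed
  then show ?thesis using limit_pair_meets_inside[OF n(1)] assms by blast
qed

lemma limiting_ray:
  assumes "limiting P A a b" "inc A' a" "A' \<noteq> P" "\<not> between A P A'"
  shows "limiting P A' a b"
proof -
  obtain n where n: "limit_pair P b a n" "\<And>B. inc B b \<Longrightarrow> same_side n A B" "inc A a"
    using assms unfolding limiting_def by blast
  note p = limit_pairD[OF n(1)]
  obtain B where "inc B b" using A2 by blast
  then have "\<not> inc A n" using n same_sideD by blast
  then have "same_side n A A'" using same_sideI[of A a A' P n] n p assms by blast
  then have "\<And>B. inc B b \<Longrightarrow> same_side n A' B" using n same_side_trans same_side_sym by blast
  then show ?thesis unfolding limiting_def using n assms by blast
qed

lemma limit_pair_limiting:
  assumes "limit_pair P b m n" "inc Q b" "inc M m" "same_side n M Q"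
  shows "limiting P M m b"
proof -
  note p = limit_pairD[OF assms(1)]
  have "same_side n M B" if "inc B b" for B
    using same_side_if_missed[of Q b B n] same_side_trans[OF assms(4)] assms p that by blast
  then show ?thesis unfolding limiting_def using assms by blast
qed

text \<open>The two limiting rays from \<open>P\<close> are on opposite sides of \<open>PQ\<close>
  by the crossbar theorem, so either side contains one.\<close>

lemma limiting_exists:
  assumes "\<not> inc P b" "inc Q b" "inc P x" "inc Q x" "\<not> inc D x"
  shows "\<exists>A a. limiting P A a b \<and> same_side x A D"
proof -
  obtain m n where mn: "limit_pair P b m n" using limit_pair_exists assms by blast
  note p = limit_pairD[OF mn]
  obtain M where M: "inc M m" "same_side n M Q" using limit_pair_rays mn assms by blast
  obtain N where N: "inc N n" "same_side m N Q" using limit_pair_rays limit_pair_sym mn assms by blast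
  have opp: "\<not> same_side x M N" using crossbar[OF N(2) M(2) p(3) M(1) p(4) N(1) assms(3,4)] .
  have B: "\<not> inc Q m" "\<not> inc Q n" using M N same_sideD by blast+
  have "M \<noteq> P" "N \<noteq> P" using M N p same_sideD by blast+
  then have "\<not> inc M x" "\<not> inc N x"
    using line_unique[of P M m x] line_unique[of P N n x] M N B p assms by blast+
  then have "same_side x M D \<or> same_side x N D"
    using two_sides[of x M N D] opp assms same_side_sym by blast
  then show ?thesis
    using limit_pair_limiting[OF mn assms(2) M] limit_pair_limiting[OF limit_pair_sym[OF mn] assms(2) N] by blast
qed

text \<open>Of two distinct such rays, one would be inside the angle that the other forms with
  \<open>PB\<close>, and so it would meet \<open>b\<close>.\<close>

lemma limiting_unique:
  assumes "limiting P A a b" "limiting P A' a' b" "inc B b" "inc P x" "inc B x" "same_side x A A'"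
  shows "a = a'"
proof (rule ccontr)
  assume "a \<noteq> a'"
  note d = limitingD[OF assms(1)] limitingD[OF assms(2)]
  have "B \<noteq> P" using assms d by blast
  then have "same_side a A' B \<or> same_side a' A B"
    using ray_trichotomy[OF assms(6) d(2) d(1) d(9) d(8) \<open>a \<noteq> a'\<close> assms(4,5)] by blast
  then show False
    using limiting_meets[OF assms(1,3) _ assms(4,5) same_side_sym[OF assms(6)] d(9,8)]
      limiting_meets[OF assms(2,3) _ assms(4,5) assms(6) d(2,1)] d by blast
qed

text \<open>The side of \<open>PQ\<close> tells which of the two rays of \<open>b\<close> from
  \<open>Q\<close> is meant. The formula is lopsided, as only the ray \<open>PA\<close> is required
  to be limiting; \<open>asymptotic_sym\<close> restores the balance.\<close>

definition asymptotic :: "'p \<Rightarrow> 'p \<Rightarrow> 'l \<Rightarrow> 'p \<Rightarrow> 'p \<Rightarrow> 'l \<Rightarrow> bool" where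
  "asymptotic P A a Q B b \<longleftrightarrow> limiting P A a b \<and> inc Q b \<and> inc B b \<and>
     (\<exists>x. inc P x \<and> inc Q x \<and> same_side x A B)"

lemma asymptoticD:
  assumes "asymptotic P A a Q B b"
  shows "limiting P A a b" "inc Q b" "inc B b" "Q \<noteq> B" "P \<noteq> Q"
    "inc P x \<Longrightarrow> inc Q x \<Longrightarrow> same_side x A B"
proof -
  obtain y where y: "inc P y" "inc Q y" "same_side y A B" using assms unfolding asymptotic_def by blast
  show 1: "limiting P A a b" "inc Q b" "inc B b" using assms unfolding asymptotic_def by blast+
  show "Q \<noteq> B" using y same_sideD by blast
  show "P \<noteq> Q" using 1 limitingD by blast
  then show "inc P x \<Longrightarrow> inc Q x \<Longrightarrow> same_side x A B" using y line_unique by blast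
qed

text \<open>Suppose that \<open>q\<close>, which enters the angle \<open>PQB\<close>, misses
  \<open>a\<close>. A line \<open>c\<close> through \<open>B\<close> missing \<open>q\<close> meets
  \<open>a\<close> or \<open>n\<close> by A5. If it meets \<open>a\<close>, then \<open>P\<close>
  and \<open>B\<close> are joined by lines missing \<open>q\<close>, contrary to the crossbar
  theorem. If it meets \<open>n\<close>, then \<open>q\<close> crosses \<open>n\<close> at a point
  \<open>V\<close> on the side of \<open>x\<close> that contains \<open>A\<close>, which contradicts
  the crossbar theorem for \<open>a\<close> and \<open>n\<close>.\<close>

lemma asymptotic_sym_aux:
  assumes "asymptotic P A a Q B b" "inc P x" "inc Q x" "same_side b K P" "same_side x K B" "inc Q q" "inc K q"
  shows "meets q a"
proof (rule ccontr)
  assume qa: "\<not> meets q a"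
  note as = asymptoticD[OF assms(1)]
  note l = limitingD[OF as(1)]
  obtain n where n: "limit_pair P b a n" "\<forall>B. inc B b \<longrightarrow> same_side n A B"
    using as unfolding limiting_def by blast
  note p = limit_pairD[OF n(1)]
  have xAB: "same_side x A B" using as assms by blast
  have "q \<noteq> b" using assms same_sideD by blast
  then have Bq: "\<not> inc B q" using line_unique[of Q B q b] assms as by blast
  then obtain c where c: "inc B c" "\<not> meets c q" using miss_exists by blast
  have "q \<noteq> c" using c Bq by blast
  have "meets b q" using meetsI[of Q b q] as assms \<open>q \<noteq> b\<close> by blast
  then have "c \<noteq> b" using c by blast
  then have "meets c b" using meetsI as c by blast
  then have can: "meets c a \<or> meets c n" using p by blast
  have opp: "\<not> same_side q P B"
    using crossbar[OF same_side_sym[OF assms(5)] same_side_sym[OF assms(4)] assms(3,2) as(2,3) assms(6,7)] .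
  have "\<not> inc Q a" using meetsI[of Q a b] l as by blast
  then have "q \<noteq> a" using assms by blast
  then have Pq: "\<not> inc P q" using meetsI[of P q a] l qa by blast
  have "\<not> meets c a"
  proof
    assume "meets c a"
    then obtain Y where Y: "inc Y c" "inc Y a" by (blast elim: meetsE)
    have "same_side q P Y" "same_side q Y B"
      using same_side_if_missed[of P a Y q] same_side_if_missed[of Y c B q] Y l c qa \<open>q \<noteq> a\<close> \<open>q \<noteq> c\<close>
        meets_sym by blast+
    then show False using opp same_side_trans by blast
  qed
  then obtain W where W: "inc W c" "inc W n" using can by (blast elim: meetsE)
  have "same_side q B W" using same_side_if_missed[of B c W q] c W \<open>q \<noteq> c\<close> by blast
  then have "\<not> same_side q P W" "\<not> inc W q" using opp same_side_trans same_side_sym same_sideD by blast+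
  then obtain V where V: "inc V q" "between P V W" using not_same_sideD Pq by blast
  have Vn: "inc V n" using between_inc V p W by metis
  have VP: "V \<noteq> P" using between_distinct[OF V(2)] by blast
  have "same_side b V P" using same_side_if_missed[of V n P b] Vn p by blast
  then have bVK: "same_side b V K" using assms same_side_trans same_side_sym by blast
  have Qn: "\<not> inc Q n" using meetsI[of Q n b] as p by blast
  then have "\<not> inc V x" using line_unique[of P V x n] Vn p assms VP by blast
  moreover have "\<not> between V Q K" using bVK same_sideD as by blast
  moreover have "K \<noteq> Q" using assms as same_sideD by blast
  ultimately have "same_side x V K" using same_sideI[of V q K Q x] V assms by blast
  then have xVA: "same_side x V A" using assms xAB same_side_trans same_side_sym by blast
  have "same_side a V Q" using same_side_if_missed[of V q Q a] V assms qa \<open>q \<noteq> a\<close> by blast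
  moreover have "same_side n A Q" using n as by blast
  ultimately have "\<not> same_side x A V"
    using crossbar[of a V Q n A P x] l Vn p assms by blast
  then show False using xVA same_side_sym by blast
qed

text \<open>Let \<open>b'\<close> carry the limiting ray from \<open>Q\<close> to \<open>a\<close>
  on the side of \<open>B\<close>. If \<open>b\<close> were inside its angle, \<open>b\<close> would
  meet \<open>a\<close>; if \<open>b'\<close> were inside the angle of \<open>b\<close>, it would
  meet \<open>a\<close> by the previous lemma.\<close>

lemma asymptotic_sym:
  assumes "asymptotic P A a Q B b" shows "asymptotic Q B b P A a"
proof -
  note as = asymptoticD[OF assms]
  note l = limitingD[OF as(1)]
  obtain x where x: "inc P x" "inc Q x" using join_exists by blast
  have xAB: "same_side x A B" using as x by blast
  have "\<not> inc Q a" using meetsI[of Q a b] l as by blast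
  then obtain B' b' where b': "limiting Q B' b' a" "same_side x B' B"
    using limiting_exists[of Q a P x B] l x xAB same_sideD by blast
  note l' = limitingD[OF b'(1)]
  have "b' = b"
  proof (rule ccontr)
    assume "b' \<noteq> b"
    then have "same_side b' B P \<or> same_side b B' P"
      using ray_trichotomy[OF b'(2) l'(2,1) as(2,3) _ x(2,1) as(5)] by blast
    then show False
      using asymptotic_sym_aux[OF assms x _ b'(2) l'(2,1)]
        limiting_meets[OF b'(1) l(2) _ x(2,1) same_side_sym[OF b'(2)] as(2,3)] l l' by blast
  qed
  moreover have "\<not> between B' Q B" using b' x same_sideD by blast
  ultimately have "limiting Q B b a" using limiting_ray[OF b'(1)] as by blast
  then show ?thesis unfolding asymptotic_def using l x xAB same_side_sym by blast
qed

text \<open>The rays \<open>QB\<close> and \<open>SD\<close> of one line point the same way: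
  \<open>F\<close> is a point of both rays that is not between their origins. This replaces an
  orientation of the line.\<close>

definition codirected :: "'l \<Rightarrow> 'p \<Rightarrow> 'p \<Rightarrow> 'p \<Rightarrow> 'p \<Rightarrow> bool" where
  "codirected b Q B S D \<longleftrightarrow> inc Q b \<and> inc B b \<and> inc S b \<and> inc D b \<and> Q \<noteq> B \<and> S \<noteq> D \<and>
    (\<exists>F. inc F b \<and> F \<noteq> Q \<and> F \<noteq> S \<and> \<not> between B Q F \<and> \<not> between D S F \<and> \<not> between Q F S)"

lemma codirected_sym: "codirected b Q B S D \<Longrightarrow> codirected b S D Q B"
  unfolding codirected_def using between_sym by blast

lemma codirected_exists:
  assumes "inc Q b" "inc B b" "inc S b" "Q \<noteq> B" shows "\<exists>D. codirected b Q B S D"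
proof -
  consider "S = Q" | "between B Q S" | "S \<noteq> Q" "\<not> between B Q S" by blast
  then show ?thesis
  proof cases
    case 1
    then have "codirected b Q B S B"
      unfolding codirected_def using assms between_distinct by blast
    then show ?thesis by blast
  next
    case 2
    then have "codirected b Q B S B"
      unfolding codirected_def using assms between_distinct between_unique[OF 2] by metis
    then show ?thesis by blast
  next
    case 3
    then obtain F where F: "between Q S F" using between_extend by metis
    have "inc F b" using between_inc F assms by metis
    moreover have "\<not> between B Q F"
      using between_trans1[of F S Q B] F 3 between_sym by blast
    ultimately have "codirected b Q B S F"
      unfolding codirected_def using assms between_distinct[OF F] between_distinct between_unique'[OF F] by metis
    then show ?thesis by blast
  qed
qed

lemma asymptoticD2:
  assumes "asymptotic P A a Q B b"
  shows "inc P a" "inc A a" "P \<noteq> A" "inc Q b" "inc B b" "Q \<noteq> B" "a \<noteq> b" "\<not> meets a b"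
    "inc X a \<Longrightarrow> \<not> inc X b"
  using asymptoticD[OF assms] limitingD[of P A a b] meetsI by blast+

text \<open>As \<open>F\<close> is on both rays, it suffices that \<open>A\<close> and
  \<open>F\<close> are on the same side of \<open>PS\<close>. If \<open>Q\<close> is between
  \<open>S\<close> and \<open>F\<close>, this is traced through the point where \<open>PQ\<close>
  cuts \<open>SA\<close>; if \<open>S\<close> is between \<open>Q\<close> and \<open>F\<close>, the
  opposite would let the crossbar theorem at \<open>P\<close> separate \<open>Q\<close> from
  \<open>S\<close> by \<open>a\<close>.\<close>

lemma asymptotic_codirected:
  assumes "asymptotic P A a Q B b" "codirected b Q B S D" shows "asymptotic P A a S D b"
proof -
  note as = asymptoticD[OF assms(1)] asymptoticD2[OF assms(1)]
  obtain F where F: "inc F b" "F \<noteq> Q" "F \<noteq> S" "\<not> between B Q F" "\<not> between D S F" "\<not> between Q F S"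
    and S: "inc S b" "inc D b" "S \<noteq> D" using assms unfolding codirected_def by blast
  obtain x where x: "inc P x" "inc Q x" using join_exists by blast
  obtain y where y: "inc P y" "inc S y" using join_exists by blast
  have Pb: "\<not> inc P b" using as by blast
  then have xy: "x \<noteq> b" "y \<noteq> b" using x y by blast+
  have xAB: "same_side x A B" using as x by blast
  have "same_side x B F" using same_sideI[of B b F Q x] as F x xAB same_sideD by blast
  then have xAF: "same_side x A F" using xAB same_side_trans by blast
  have Fy: "\<not> inc F y" using line_unique[of F S b y] F S y xy by blast
  have Dy: "\<not> inc D y" using line_unique[of D S b y] S y xy by blast
  have Ay: "\<not> inc A y" using line_unique[of A P a y] as(7-9) y S as by blast
  have yDF: "same_side y D F" using same_sideI[of D b F S y] S F y Dy by blast
  have "same_side y A F"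
  proof (cases "S = Q")
    case True
    then have "y = x" using x y line_unique as by blast
    then show ?thesis using xAF by blast
  next
    case SQ: False
    have Sx: "\<not> inc S x" using line_unique[of S Q b x] S as x xy SQ by blast
    have Qy: "\<not> inc Q y" using line_unique[of S Q b y] S as y xy SQ by blast
    have Sa: "\<not> inc S a" "\<not> inc Q a" using as S by blast+
    have aSQ: "same_side a S Q" using same_side_if_missed[of S b Q a] S as meets_sym by blast
    consider "between S Q F" | "between Q S F"
      using trichotomy[of S Q F b] S as F SQ between_sym by blast
    then show ?thesis
    proof cases
      case 1
      then have "\<not> same_side x S A" using x xAF same_side_trans same_sideD by blast
      then obtain T where T: "inc T x" "between S T A" using not_same_sideD Sx xAB same_sideD by blast
      have Ta: "\<not> inc T a" using between_inc(3)[OF T(2)] as Sa by blast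
      have Ty: "\<not> inc T y" using between_inc(1)[OF T(2)] y Ay by blast
      have "same_side a T S" using same_side_between between_sym T as Ta by blast
      then have "same_side a T Q" using aSQ same_side_trans by blast
      then have "\<not> between T P Q" using same_sideD as by blast
      then have "same_side y T Q" using same_sideI[of T x Q P y] T x y Ty as by blast
      moreover have "same_side y T A" using same_side_between T y Ty by blast
      moreover have "same_side y Q F" using same_side_between 1 y Qy by blast
      ultimately show ?thesis using same_side_trans same_side_sym by blast
    next
      case 2
      show ?thesis
      proof (rule ccontr)
        assume n: "\<not> same_side y A F"
        have "\<not> same_side y F Q" using 2 y same_sideD same_side_sym by blast
        then have "same_side y A Q" using two_sides[OF n] Ay Fy Qy by blast
        moreover have "same_side x S F" using same_side_between 2 x Sx by blast
        then have "same_side x S A" using xAF same_side_trans same_side_sym by blast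
        ultimately have "\<not> same_side a Q S"
          using crossbar[of x S A y Q P a] x y as same_side_sym by blast
        then show False using aSQ same_side_sym by blast
      qed
    qed
  qed
  then have "same_side y A D" using yDF same_side_trans same_side_sym by blast
  then show ?thesis unfolding asymptotic_def using as S y by blast
qed

lemma asymptotic_start:
  assumes "asymptotic P A a Q B b" "inc X a"
  shows "\<exists>A'. codirected a P A X A' \<and> asymptotic X A' a Q B b"
proof -
  obtain A' where A': "codirected a P A X A'"
    using codirected_exists[of P a A X] asymptoticD2[OF assms(1)] assms by blast
  then have "asymptotic Q B b X A' a" using asymptotic_codirected asymptotic_sym assms by blast
  then show ?thesis using A' asymptotic_sym by blast
qed

text \<open>Both rays can be restarted at the common point \<open>X\<close>, and a limiting ray from
  \<open>X\<close> on a given side of \<open>XQ\<close> is unique.\<close>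

lemma asymptotic_disjoint:
  assumes "asymptotic P A a Q B b" "asymptotic R C c Q B b" "inc X a" "inc X c"
  shows "a = c"
proof -
  obtain A' where A': "asymptotic X A' a Q B b" using asymptotic_start assms by blast
  obtain C' where C': "asymptotic X C' c Q B b" using asymptotic_start assms by blast
  obtain x where x: "inc X x" "inc Q x" using join_exists by blast
  have "same_side x A' C'"
    using asymptoticD(6)[OF A' x] asymptoticD(6)[OF C' x] same_side_trans same_side_sym by blast
  then show ?thesis
    using limiting_unique[OF asymptoticD(1)[OF A'] asymptoticD(1)[OF C'] asymptoticD(2)[OF A'] x] by blast
qed

text \<open>If the limiting ray \<open>c'\<close> from \<open>R\<close> to \<open>a\<close> were not
  on \<open>c\<close>, it would enter the angle between \<open>RC\<close> and \<open>RQ\<close> and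
  meet \<open>b\<close>. Then \<open>R\<close> and \<open>Q\<close> would be joined by lines missing
  \<open>a\<close>, although \<open>P\<close> is between them.\<close>

lemma asymptotic_trans_aux1:
  assumes "asymptotic Q B b P A a" "asymptotic Q B b R C c" "between Q P R" "a \<noteq> c"
  shows "asymptotic R C c P A a"
proof -
  note as = asymptoticD[OF assms(1)] asymptoticD2[OF assms(1)]
  note cs = asymptoticD[OF assms(2)] asymptoticD2[OF assms(2)]
  have disj: "\<not> (inc X a \<and> inc X c)" for X
    using asymptotic_disjoint[OF asymptotic_sym asymptotic_sym] assms by blast
  then have Ra: "\<not> inc R a" "\<not> inc P c" using cs as by blast+
  obtain x where x: "inc Q x" "inc P x" "inc R x" using between_line assms by blast
  have xAC: "same_side x B A" "same_side x B C" using as cs x by blast+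
  obtain C' c' where c': "limiting R C' c' a" "same_side x C' C"
    using limiting_exists[of R a P x C] Ra as x xAC same_sideD by blast
  note l' = limitingD[OF c'(1)]
  have lR: "limiting R C c b" using asymptotic_sym[OF assms(2)] asymptoticD by blast
  have PR: "P \<noteq> R" using between_distinct assms by blast
  have "c' = c"
  proof (rule ccontr)
    assume "c' \<noteq> c"
    then have "same_side c' C P \<or> same_side c C' P"
      using ray_trichotomy[OF c'(2) l'(2,1) cs(2,3) _ x(3,2) PR] by blast
    moreover have "\<not> same_side c' C P"
    proof
      assume "same_side c' C P"
      then have "meets c a"
        using limiting_meets[OF c'(1) as(2) _ x(3,2) same_side_sym[OF c'(2)] cs(2,3)] by blast
      then show False using disj by (blast elim: meetsE)
    qed
    ultimately have "same_side c C' P" by blast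
    moreover have "same_side c P Q" using same_side_between[of R c P Q] cs assms(3) between_sym Ra by blast
    ultimately have "same_side c C' Q" using same_side_trans by blast
    then have "meets c' b" using limiting_meets[OF lR as(7) _ x(3,1) c'(2) l'(2,1)] by blast
    then obtain T where T: "inc T c'" "inc T b" by (blast elim: meetsE)
    have "same_side a R T" "same_side a T Q"
      using same_side_if_missed[of R c' T a] same_side_if_missed[of T b Q a] T l' as by blast+
    then have "same_side a R Q" using same_side_trans by blast
    then show False using assms(3) as same_sideD between_sym by blast
  qed
  moreover have "\<not> between C' R C" using c' x same_sideD by blast
  ultimately have "limiting R C c a" using limiting_ray c' cs by blast
  moreover have "same_side x C A" using xAC same_side_trans same_side_sym by blast
  ultimately show ?thesis unfolding asymptotic_def using as x by blast
qed

lemma asymptotic_trans_aux2: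
  assumes "asymptotic Q B b P A a" "asymptotic Q B b R C c" "\<not> same_side a Q R" "a \<noteq> c"
  shows "asymptotic R C c P A a"
proof -
  have "\<not> inc Q a" "\<not> inc R a"
    using asymptoticD2[OF assms(1)] asymptoticD2[OF assms(2)]
      asymptotic_disjoint[OF asymptotic_sym[OF assms(1)] asymptotic_sym[OF assms(2)]] assms(4) by blast+
  then obtain X where X: "inc X a" "between Q X R" using not_same_sideD assms by blast
  obtain A' where A': "codirected a P A X A'"
    using codirected_exists[of P a A X] asymptoticD2[OF assms(1)] X by blast
  then have "asymptotic Q B b X A' a" using asymptotic_codirected assms by blast
  then have "asymptotic R C c X A' a" using asymptotic_trans_aux1 assms X by blast
  then show ?thesis using asymptotic_codirected codirected_sym A' by blast
qed

text \<open>If the limiting ray \<open>a'\<close> from \<open>P\<close> to \<open>c\<close> were not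
  on \<open>a\<close>, it would meet \<open>b\<close>. Two lines asymptotic to \<open>RC\<close>
  with a common point coincide, but \<open>P\<close> is not on \<open>b\<close>.\<close>

lemma asymptotic_trans_aux3:
  assumes "asymptotic Q B b P A a" "asymptotic Q B b R C c" "between P Q R" "a \<noteq> c"
  shows "asymptotic P A a R C c"
proof -
  note as = asymptoticD[OF assms(1)] asymptoticD2[OF assms(1)]
  note cs = asymptoticD[OF assms(2)] asymptoticD2[OF assms(2)]
  have disj: "\<not> (inc X a \<and> inc X c)" for X
    using asymptotic_disjoint[OF asymptotic_sym asymptotic_sym] assms by blast
  then have Pc: "\<not> inc P c" using as by blast
  have Qa: "\<not> inc Q a" "\<not> inc P b" using as by blast+
  obtain x where x: "inc P x" "inc Q x" "inc R x" using between_line assms by blast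
  have xAC: "same_side x B A" "same_side x B C" using as cs x by blast+
  obtain A' a' where a': "limiting P A' a' c" "same_side x A' A"
    using limiting_exists[of P c R x A] Pc cs x xAC same_sideD by blast
  note l' = limitingD[OF a'(1)]
  have lP: "limiting P A a b" using asymptotic_sym[OF assms(1)] asymptoticD by blast
  have RP: "R \<noteq> P" using between_distinct assms by blast
  have "same_side x A' C" using a' xAC same_side_trans same_side_sym by blast
  then have P': "asymptotic P A' a' R C c" unfolding asymptotic_def using a' cs x by blast
  have "a' = a"
  proof (rule ccontr)
    assume "a' \<noteq> a"
    then have "same_side a' A R \<or> same_side a A' R"
      using ray_trichotomy[OF a'(2) l'(2,1) as(2,3) _ x(1,3) RP] by blast
    moreover have "\<not> same_side a' A R"
    proof
      assume "same_side a' A R"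
      then have "meets a c"
        using limiting_meets[OF a'(1) cs(2) _ x(1,3) same_side_sym[OF a'(2)] as(2,3)] by blast
      then show False using disj by (blast elim: meetsE)
    qed
    ultimately have "same_side a A' R" by blast
    moreover have "same_side a Q R" using same_side_between[of P a Q R] as assms(3) Qa by blast
    ultimately have "same_side a A' Q" using same_side_trans same_side_sym by blast
    then have "meets a' b" using limiting_meets[OF lP as(7) _ x(1,2) a'(2) l'(2,1)] by blast
    then obtain T where "inc T a'" "inc T b" by (blast elim: meetsE)
    then have "a' = b" using asymptotic_disjoint[OF P' assms(2)] by blast
    then show False using l' Qa by blast
  qed
  then have "limiting P A a c" using limiting_ray[OF a'(1), of A] a' x same_sideD as by blast
  moreover have "same_side x A C" using xAC same_side_trans same_side_sym by blast
  ultimately show ?thesis unfolding asymptotic_def using cs x by blast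
qed

text \<open>If \<open>b\<close> leaves \<open>P\<close> and \<open>R\<close> on one side, then one
  of \<open>QP\<close> and \<open>QR\<close> is inside the angle that the other forms with
  \<open>QB\<close>. Hence \<open>QR\<close> meets \<open>a\<close> or \<open>QP\<close> meets
  \<open>c\<close>, and the position of the meeting point shows that one of the three lines
  separates points of the other two.\<close>

lemma asymptotic_separates:
  assumes "asymptotic Q B b P A a" "asymptotic Q B b R C c" "a \<noteq> c"
  shows "\<not> same_side b P R \<or> \<not> same_side a Q R \<or> \<not> same_side c Q P"
proof (rule ccontr)
  assume n: "\<not> ?thesis"
  note as = asymptoticD[OF assms(1)] asymptoticD2[OF assms(1)]
  note cs = asymptoticD[OF assms(2)] asymptoticD2[OF assms(2)]
  have disj: "\<not> (inc X a \<and> inc X c)" for X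
    using asymptotic_disjoint[OF asymptotic_sym asymptotic_sym] assms by blast
  have ss: "same_side b P R" "same_side a Q R" "same_side c Q P" using n by blast+
  obtain x where x: "inc Q x" "inc P x" using join_exists by blast
  obtain y where y: "inc Q y" "inc R y" using join_exists by blast
  have meet_a: False if X: "inc X a" "inc X y" for X
  proof -
    have "same_side b X P" using same_side_if_missed[of X a P b] X as meets_sym by blast
    then have "same_side b X R" using ss same_side_trans by blast
    then have "\<not> between X Q R" using same_sideD as by blast
    moreover have "X \<noteq> Q" "X \<noteq> R" using X as cs disj by blast+
    moreover have "\<not> between Q X R" using ss X same_sideD by blast
    ultimately have "between Q R X" using trichotomy[of Q X R y] X y cs by blast
    then have "\<not> same_side c Q X" using cs same_sideD by blast
    moreover have "same_side c P X"
      using same_side_if_missed[of P a X c] X as disj by (blast elim: meetsE)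
    ultimately show False using ss same_side_trans by blast
  qed
  have meet_c: False if X: "inc X c" "inc X x" for X
  proof -
    have "same_side b X R" using same_side_if_missed[of X c R b] X cs meets_sym by blast
    then have "same_side b X P" using ss same_side_trans same_side_sym by blast
    then have "\<not> between X Q P" using same_sideD as by blast
    moreover have "X \<noteq> Q" "X \<noteq> P" using X as cs disj by blast+
    moreover have "\<not> between Q X P" using ss X same_sideD by blast
    ultimately have "between Q P X" using trichotomy[of Q X P x] X x as by blast
    then have "\<not> same_side a Q X" using as same_sideD by blast
    moreover have "same_side a R X"
      using same_side_if_missed[of R c X a] X cs disj by (blast elim: meetsE)
    ultimately show False using ss same_side_trans by blast
  qed
  show False
  proof (cases "x = y")
    case True
    then show False using meet_a as x by blast
  next
    case False
    then have "same_side x R B \<or> same_side y P B"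
      using ray_trichotomy[OF ss(1) x y _ _ as(8)] as by metis
    then have "meets y a \<or> meets x c"
      using limiting_meets[OF as(1) as(2) same_side_sym[OF ss(1)] x _ y]
        limiting_meets[OF cs(1) cs(2) ss(1) y _ x] by blast
    then show False using meet_a meet_c by (blast elim: meetsE)
  qed
qed

lemma asymptotic_trans:
  assumes "asymptotic Q B b P A a" "asymptotic Q B b R C c" "a \<noteq> c"
  shows "asymptotic P A a R C c"
proof (cases "same_side b P R")
  case True
  then consider "\<not> same_side a Q R" | "\<not> same_side c Q P" using asymptotic_separates assms by blast
  then show ?thesis
    using asymptotic_trans_aux2[OF assms(1,2) _ assms(3)] asymptotic_trans_aux2[OF assms(2,1)]
      asymptotic_sym assms(3) by cases blast+
next
  case False
  note as = asymptoticD[OF assms(1)] asymptoticD2[OF assms(1)]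
  have "\<not> inc P b" "\<not> inc R b" using as asymptoticD2[OF assms(2)] by blast+
  then obtain S where S: "inc S b" "between P S R" using not_same_sideD False by blast
  obtain D where D: "codirected b Q B S D" using codirected_exists[of Q b B S] as S by blast
  have "asymptotic S D b P A a" "asymptotic S D b R C c"
    using asymptotic_codirected asymptotic_sym assms D by blast+
  then show ?thesis using asymptotic_trans_aux3 S assms by blast
qed

lemma asymptotic_exists:
  assumes "inc P a" "inc A a" "P \<noteq> A" "\<not> inc R a"
  shows "\<exists>C c. asymptotic P A a R C c"
proof -
  obtain x where x: "inc R x" "inc P x" using join_exists by blast
  have "\<not> inc A x" using line_unique[of P A a x] assms x by blast
  then obtain C c where "limiting R C c a" "same_side x C A"
    using limiting_exists[OF assms(4,1) x] by blast
  then have "asymptotic R C c P A a" unfolding asymptotic_def using assms x by blast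
  then show ?thesis using asymptotic_sym by blast
qed

text \<open>The end of the ray \<open>PA\<close>, given by all the lines through it. The line
  \<open>a\<close> has to be added, since asymptotic rays lie on different lines.\<close>

definition pencil :: "'p \<Rightarrow> 'p \<Rightarrow> 'l \<Rightarrow> 'l set" where
  "pencil P A a = {c. c = a \<or> (\<exists>Q B. asymptotic P A a Q B c)}"

definition is_end :: "'l set \<Rightarrow> bool" where
  "is_end e \<longleftrightarrow> (\<exists>P A a. inc P a \<and> inc A a \<and> P \<noteq> A \<and> e = pencil P A a)"

lemma pencil_subset:
  assumes "asymptotic P A a Q B b" shows "pencil P A a \<subseteq> pencil Q B b"
  using assms asymptotic_sym asymptotic_trans unfolding pencil_def by blast

lemma pencil_eq: "asymptotic P A a Q B b \<Longrightarrow> pencil P A a = pencil Q B b"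
  using pencil_subset asymptotic_sym by blast

lemma pencil_codirected:
  assumes "codirected a P A Q B" shows "pencil P A a = pencil Q B a"
proof -
  have h: "inc P a" "inc A a" "P \<noteq> A" using assms unfolding codirected_def by blast+
  obtain R where "\<not> inc R a" using off_line by blast
  then obtain C c where "asymptotic P A a R C c" using asymptotic_exists h by blast
  moreover then have "asymptotic Q B a R C c"
    using asymptotic_codirected asymptotic_sym assms by blast
  ultimately show ?thesis using pencil_eq by metis
qed

lemma end_at:
  assumes "is_end e" "a \<in> e" "inc P a" shows "\<exists>A. inc A a \<and> P \<noteq> A \<and> e = pencil P A a"
proof -
  obtain Q B b where e: "inc Q b" "inc B b" "Q \<noteq> B" "e = pencil Q B b"
    using assms unfolding is_end_def by blast
  then consider "a = b" | R C where "asymptotic Q B b R C a" using assms unfolding pencil_def by blast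
  then have "\<exists>R C. inc R a \<and> inc C a \<and> R \<noteq> C \<and> e = pencil R C a"
  proof cases
    case 1 then show ?thesis using e by blast
  next
    case 2
    then show ?thesis using e pencil_eq[OF 2] asymptoticD2[OF 2] by blast
  qed
  then obtain R C where R: "inc R a" "inc C a" "R \<noteq> C" "e = pencil R C a" by blast
  then obtain A where "codirected a R C P A" using codirected_exists assms by blast
  then show ?thesis using pencil_codirected R unfolding codirected_def by blast
qed

lemma end_line_exists:
  assumes "is_end e" shows "\<exists>c\<in>e. inc R c"
proof -
  obtain P A a where e: "inc P a" "inc A a" "P \<noteq> A" "e = pencil P A a"
    using assms unfolding is_end_def by blast
  show ?thesis
  proof (cases "inc R a")
    case True then show ?thesis using e unfolding pencil_def by blast
  next
    case False
    then obtain C c where "asymptotic P A a R C c" using asymptotic_exists e by blast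
    then show ?thesis using e asymptoticD unfolding pencil_def by blast
  qed
qed

lemma end_disjoint:
  assumes "is_end e" "a \<in> e" "b \<in> e" "inc R a" "inc R b" shows "a = b"
proof -
  obtain A where "e = pencil R A a" using end_at assms by blast
  then show ?thesis using assms asymptoticD2(9) unfolding pencil_def by blast
qed

lemma end_not_meets: "is_end e \<Longrightarrow> a \<in> e \<Longrightarrow> b \<in> e \<Longrightarrow> \<not> meets a b"
  using end_disjoint by (blast elim: meetsE)

lemma end_asymptotic:
  assumes "is_end e" "a \<in> e" "b \<in> e" "a \<noteq> b" "inc P a" "inc Q b"
  shows "\<exists>A B. asymptotic P A a Q B b \<and> e = pencil P A a"
proof -
  obtain A where A: "inc A a" "P \<noteq> A" "e = pencil P A a" using end_at assms by blast
  then obtain R C where "asymptotic P A a R C b" using assms unfolding pencil_def by blast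
  then show ?thesis using A asymptotic_start asymptotic_sym assms by blast
qed

text \<open>The second line \<open>n\<close> of A5 has its limiting ray on the side of
  \<open>x\<close> that does not contain \<open>A\<close>, which is the side of \<open>A'\<close>;
  uniqueness would give \<open>n = a\<close>. This is why two lines share at most one end.\<close>

lemma limiting_opposite:
  assumes "limiting P A a b" "limiting P A' a b" shows "\<not> between A P A'"
proof
  assume b: "between A P A'"
  note l = limitingD[OF assms(1)] limitingD[OF assms(2)]
  obtain Q where Q: "inc Q b" using A2 by blast
  obtain n where n: "limit_pair P b a n" "same_side n A Q" using assms Q unfolding limiting_def by blast
  note p = limit_pairD[OF n(1)]
  obtain N where N: "inc N n" "same_side a N Q" using limit_pair_rays limit_pair_sym n Q by blast
  obtain x where x: "inc P x" "inc Q x" using join_exists by blast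
  have lN: "limiting P N n b" using limit_pair_limiting[OF limit_pair_sym[OF n(1)] Q N] .
  have nN: "\<not> same_side x N A"
    using crossbar[OF N(2) n(2) p(3) l(1) p(4) N(1) x] same_side_sym by blast
  have nA: "\<not> same_side x A A'" using b x same_sideD by blast
  have "\<not> inc Q a" "\<not> inc Q n" using N n same_sideD by blast+
  moreover have "N \<noteq> P" using N p same_sideD by blast
  ultimately have "\<not> inc N x" "\<not> inc A x" "\<not> inc A' x"
    using line_unique[of P N n x] line_unique[of P A a x] line_unique[of P A' a x] l N p x by blast+
  then have "same_side x N A'" using two_sides nN nA by blast
  then have "n = a" using limiting_unique[OF lN assms(2) Q x] by blast
  then show False using p by blast
qed

lemma end_unique:
  assumes "is_end e" "is_end f" "a \<in> e" "a \<in> f" "b \<in> e" "b \<in> f" "a \<noteq> b" shows "e = f"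
proof -
  obtain P where P: "inc P a" using A2 by blast
  obtain Q where Q: "inc Q b" using A2 by blast
  obtain A B where A: "asymptotic P A a Q B b" "e = pencil P A a" using end_asymptotic assms P Q by blast
  obtain A' B' where A': "asymptotic P A' a Q B' b" "f = pencil P A' a"
    using end_asymptotic assms P Q by blast
  have "\<not> between A P A'" using limiting_opposite asymptoticD A A' by blast
  then have "codirected a P A P A'"
    unfolding codirected_def using asymptoticD2[OF A(1)] asymptoticD2[OF A'(1)] between_distinct
      between_sym by blast
  then show ?thesis using pencil_codirected A A' by blast
qed

text \<open>The ends are those of two opposite rays from a point \<open>P\<close>. They differ
  because a line asymptotic to one ray is not asymptotic to the other, and a third ray from
  \<open>P\<close> agrees with one of them because \<open>P\<close> cannot separate three points
  pairwise.\<close>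

lemma line_two_ends:
  "\<exists>e f. is_end e \<and> is_end f \<and> e \<noteq> f \<and> a \<in> e \<and> a \<in> f \<and> (\<forall>g. is_end g \<longrightarrow> a \<in> g \<longrightarrow> g = e \<or> g = f)"
proof -
  obtain P where P: "inc P a" using A2 by blast
  obtain A where A: "inc A a" "A \<noteq> P" using second_point P by blast
  then obtain A' where A': "between A P A'" using between_extend by blast
  then have a': "inc A' a" "A' \<noteq> P" using between_inc A P between_distinct by metis+
  obtain R where R: "\<not> inc R a" using off_line by blast
  obtain C c where c: "asymptotic P A a R C c" using asymptotic_exists P A R by metis
  have "pencil P A a \<noteq> pencil P A' a"
  proof
    assume "pencil P A a = pencil P A' a"
    moreover have "c \<in> pencil P A a" using c unfolding pencil_def by blast
    ultimately have "c \<in> pencil P A' a" by simp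
    then obtain Q B where "asymptotic P A' a Q B c"
      using asymptoticD2(7)[OF c] unfolding pencil_def by blast
    then show False using limiting_opposite[OF asymptoticD(1)[OF c]] asymptoticD(1) A' by blast
  qed
  moreover have "is_end (pencil P A a)" "is_end (pencil P A' a)" "a \<in> pencil P A a" "a \<in> pencil P A' a"
    unfolding is_end_def using P A a' by (blast, blast) (simp_all add: pencil_def)
  moreover have "g = pencil P A a \<or> g = pencil P A' a" if g: "is_end g" "a \<in> g" for g
  proof -
    obtain D where D: "inc D a" "P \<noteq> D" "g = pencil P D a" using end_at g P by blast
    have "\<not> between D P A \<or> \<not> between D P A'"
    proof (rule ccontr)
      assume "\<not> ?thesis"
      moreover obtain x where x: "inc P x" "x \<noteq> a" using other_line P by blast
      ultimately have "\<not> same_side x D A" "\<not> same_side x A A'" "\<not> same_side x D A'"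
        using A' same_sideD same_side_sym by blast+
      moreover have "\<not> inc D x" "\<not> inc A x" "\<not> inc A' x"
        using line_unique[of P D a x] line_unique[of P A a x] line_unique[of P A' a x] P x D A a'
        by blast+
      ultimately show False using two_sides by blast
    qed
    moreover have "codirected a P D P X" if "inc X a" "X \<noteq> P" "\<not> between D P X" for X
      unfolding codirected_def using D P that between_distinct by blast
    ultimately have "codirected a P D P A \<or> codirected a P D P A'" using A a' by blast
    then show ?thesis using pencil_codirected D by blast
  qed
  ultimately show ?thesis by blast
qed

subsection \<open>Parallel lines\<close>

lemma ray_iff:
  assumes "inc P a" "inc A a" "P \<noteq> A"
  shows "X \<in> ray P A \<longleftrightarrow> inc X a \<and> \<not> between X P A"
proof -
  have "inc X a" if "X \<in> ray P A" using that assms between_inc unfolding ray_def by blast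
  moreover have "between P X A \<or> between P A X" if "inc X a" "\<not> between X P A" "X \<noteq> P" "X \<noteq> A"
    using trichotomy[of X P A a] that assms between_sym by blast
  moreover have "\<not> between X P A" if "X \<in> ray P A"
    using that between_distinct between_unique between_unique' between_sym unfolding ray_def by blast
  ultimately show ?thesis unfolding ray_def by blast
qed

lemma segment_sym: "segment P Q = segment Q P"
  unfolding segment_def using between_sym by blast

text \<open>For a point \<open>K\<close> of \<open>k\<close> inside the angle of \<open>PA\<close>
  and \<open>PQ\<close>, the line \<open>PK\<close> meets \<open>b\<close> at some \<open>T\<close>.
  If \<open>K\<close> is between \<open>P\<close> and \<open>T\<close>, then \<open>k\<close>,
  having \<open>P\<close> and \<open>Q\<close> on one side, cuts \<open>TQ\<close>; if
  \<open>T\<close> is between \<open>P\<close> and \<open>K\<close>, then \<open>b\<close> cuts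
  \<open>XK\<close>; if \<open>T\<close> is on \<open>k\<close>, it serves itself.\<close>

lemma transversal_ray:
  assumes as: "asymptotic P A a Q B b" and X: "inc X a" "\<not> between X P A" "inc X k"
    and k: "\<not> meets_set k (segment P Q)"
  shows "\<exists>Y. inc Y k \<and> inc Y b \<and> \<not> between Y Q B"
proof -
  note d = asymptoticD[OF as] asymptoticD2[OF as]
  have Pk: "\<not> inc P k" and Qk: "\<not> inc Q k" and PQ: "same_side k P Q"
    using k unfolding meets_set_def segment_def same_side_def by blast+
  have XP: "X \<noteq> P" and ka: "k \<noteq> a" using X Pk d by blast+
  obtain x where x: "inc P x" "inc Q x" using join_exists by blast
  have Qa: "\<not> inc Q a" and Pb: "\<not> inc P b" using d by blast+
  have Xx: "\<not> inc X x" using line_unique[of X P a x] X d x XP Qa by blast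
  have Ax: "\<not> inc A x" using line_unique[of A P a x] d x Qa by blast
  have xXA: "same_side x X A" using same_sideI[of X a A P x] X d x Xx by blast
  then have xXB: "same_side x X B" using d x same_side_trans by blast
  \<comment> \<open>The point \<open>Z\<close> is taken on \<open>x\<close> if \<open>k\<close>
    meets \<open>x\<close>; otherwise all of \<open>k\<close> is on the side of \<open>x\<close>
    that contains \<open>X\<close>. Then \<open>K\<close> is chosen between \<open>X\<close> and
    \<open>Z\<close> or beyond \<open>X\<close>, whichever puts it on the side of \<open>a\<close>
    that contains \<open>Q\<close>.\<close>
  have "\<exists>Z. inc Z k \<and> Z \<noteq> X \<and> (meets k x \<longrightarrow> inc Z x)"
    using second_point X Xx by (metis meetsE)
  then obtain Z where Z: "inc Z k" "Z \<noteq> X" "meets k x \<Longrightarrow> inc Z x" by blast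
  have kx: "k \<noteq> x" using x Pk by blast
  have Za: "\<not> inc Z a" using line_unique[of Z X k a] X Z ka by blast
  have miss: "same_side x K X" if "\<not> inc Z x" "inc K k" for K
    using same_side_if_missed[of K k X x] that X Z kx by blast
  have "\<exists>K. inc K k \<and> same_side a K Q \<and> same_side x K X"
  proof (cases "same_side a Z Q")
    case True
    obtain K where K: "between X K Z" using between_dense Z by metis
    have Kk: "inc K k" using between_inc K X Z by metis
    have "\<not> inc K a" using line_unique[of K X k a] between_distinct[OF K] Kk X ka by blast
    then have "same_side a K Q" using same_side_between[OF _ K] X True same_side_trans by blast
    moreover have "same_side x K X" if "inc Z x"
      using same_side_between[of Z x K X] that K between_sym between_inc(1)[OF between_sym[OF K]] Xx by blast
    ultimately show ?thesis using Kk miss by blast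
  next
    case False
    obtain K where K: "between Z X K" using between_extend Z by metis
    have Kk: "inc K k" using between_inc K X Z by metis
    have "\<not> inc K a" using line_unique[of K X k a] between_distinct[OF K] Kk X ka by blast
    moreover have "\<not> same_side a K Z" using K X same_sideD between_sym by blast
    ultimately have "same_side a K Q" using two_sides False Za Qa by blast
    moreover have "same_side x K X" if "inc Z x"
      using same_side_between[OF that K Xx] same_side_sym by blast
    ultimately show ?thesis using Kk miss by blast
  qed
  then obtain K where K: "inc K k" "same_side a K Q" "same_side x K X" by blast
  obtain p where p: "inc P p" "inc K p" using join_exists by blast
  have "same_side x K A" using K xXA same_side_trans by blast
  then have "meets p b" using limiting_meets[OF d(1,2) K(2) x _ p] by blast
  then obtain T where T: "inc T p" "inc T b" by (blast elim: meetsE)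
  have "same_side a T Q" using same_side_if_missed[of T b Q a] T d meets_sym by blast
  then have aTK: "same_side a K T" using K same_side_trans same_side_sym by blast
  then have nKPT: "\<not> between K P T" using same_sideD d by blast
  have "T \<noteq> P" using T Pb by blast
  then have "same_side x K T" using same_sideI[of K p T P x] p T x K same_sideD nKPT by blast
  then have xTX: "same_side x T X" using K same_side_trans same_side_sym by blast
  have on_ray: "\<not> between Y Q B" if "same_side x Y X" for Y
    using same_side_trans[OF that xXB] same_sideD x by blast
  show ?thesis
  proof (cases "inc T k")
    case True
    then show ?thesis using T xTX on_ray by blast
  next
    case Tk: False
    have "K \<noteq> T" "K \<noteq> P" using Tk K Pk by blast+
    then consider "between P K T" | "between P T K"
      using trichotomy[of P K T p] p T nKPT \<open>T \<noteq> P\<close> by metis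
    then show ?thesis
    proof cases
      case 1
      then have "\<not> same_side k T Q" using K PQ same_side_trans same_side_sym same_sideD by blast
      then obtain Y where Y: "inc Y k" "between T Y Q" using not_same_sideD Tk Qk by blast
      then have Yb: "inc Y b" using between_inc T d by metis
      have "Y \<noteq> Q" using Y Qk by blast
      moreover have "x \<noteq> b" using x Pb by blast
      ultimately have "\<not> inc Y x" using line_unique[of Y Q b x] Yb d x by blast
      then have "same_side x Y T" using same_side_between[of Q x Y T] x Y between_sym by blast
      then show ?thesis using on_ray xTX same_side_trans Y Yb by blast
    next
      case 2
      have "same_side b X P" using same_side_if_missed[of X a P b] X d by blast
      moreover have "\<not> same_side b P K" using 2 T same_sideD by blast
      ultimately have n: "\<not> same_side b X K" using same_side_trans same_side_sym by blast
      have "p \<noteq> b" using p Pb by blast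
      then have "\<not> inc K b" using line_unique[of K T p b] p T \<open>K \<noteq> T\<close> by blast
      then obtain Y where Y: "inc Y b" "between X Y K"
        using n not_same_sideD d X by blast
      have "same_side x Y X" using same_side_convex[OF K(3) between_sym[OF Y(2)]] by blast
      then show ?thesis using on_ray Y between_inc(2)[OF Y(2)] X K by blast
    qed
  qed
qed

lemma asymptotic_parallel_rays:
  assumes "asymptotic P A a Q B b" shows "parallel_rays (ray P A) (ray Q B)"
proof -
  note d = asymptoticD2[OF assms]
  note r = ray_iff[OF d(1-3)] ray_iff[OF d(4-6)]
  have 1: "meets_set k (ray Q B)" if "meets_set k (ray P A)" "\<not> meets_set k (segment P Q)" for k
    using transversal_ray[OF assms] that r unfolding meets_set_def by blast
  have 2: "meets_set k (ray P A)" if "meets_set k (ray Q B)" "\<not> meets_set k (segment P Q)" for k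
  proof -
    have "\<not> meets_set k (segment Q P)" using that segment_sym by metis
    then show ?thesis
      using transversal_ray[OF asymptotic_sym[OF assms]] that r unfolding meets_set_def by blast
  qed
  have "\<not> collinear_rays (ray P A) (ray Q B)"
  proof
    assume "collinear_rays (ray P A) (ray Q B)"
    then obtain l where l: "ray P A \<union> ray Q B \<subseteq> pts l" unfolding collinear_rays_def by blast
    have "inc P l" "inc A l" "inc Q l" using l unfolding ray_def pts_def by blast+
    then show False using line_unique[of P A l a] d by blast
  qed
  moreover have "ray_from P (ray P A)" "ray_from Q (ray Q B)" unfolding ray_from_def using d by metis+
  ultimately show ?thesis unfolding parallel_rays_def using 1 2 by blast
qed

text \<open>The hypothesis is tested on a few lines through points of \<open>RA\<close>. They are
  chosen so as to miss \<open>b\<close> or the limiting ray, or to meet \<open>b\<close> off the ray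
  \<open>SB\<close>; then what they can meet leads to a contradiction or determines a
  position.\<close>

lemma parallel_rays_asymptotic:
  assumes r: "inc R a" "inc A a" "R \<noteq> A" and s: "inc S b" "inc B b" "S \<noteq> B" and ab: "a \<noteq> b"
    and rs: "\<And>k. meets_set k (ray R A) \<Longrightarrow> meets_set k (ray S B) \<or> meets_set k (segment R S)"
  shows "asymptotic R A a S B b"
proof -
  note ri = ray_iff[OF r] ray_iff[OF s]
  have H: "(\<exists>Y. inc Y k \<and> inc Y b \<and> \<not> between Y S B) \<or> inc R k \<or> inc S k \<or> (\<exists>E. inc E k \<and> between R E S)"
    if "inc X k" "inc X a" "\<not> between X R A" for X k
    using rs[of k] that ri unfolding meets_set_def segment_def by blast
  \<comment> \<open>Let \<open>Z\<close> be a common point. A line missing \<open>b\<close> through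
    a point \<open>Y\<close> of \<open>RA\<close> must cut \<open>RS\<close>, so \<open>Y\<close>
    and \<open>R\<close> are on the same side of \<open>b\<close>; hence \<open>Z\<close> is not on
    the ray. But for \<open>Y = A\<close> this line also separates \<open>R\<close> from
    \<open>Z\<close>, which can only happen at \<open>A\<close>.\<close>
  have disj: "\<not> inc Z b" if Za: "inc Z a" for Z
  proof
    assume Zb: "inc Z b"
    have only: "Y = Z" if "inc Y a" "inc Y b" for Y using line_unique[of Y Z a b] that Za Zb ab by blast
    have same: "same_side b R Y \<and> (\<exists>y. inc Y y \<and> y \<noteq> a \<and> \<not> same_side y R S \<and> same_side y Z S)"
      if Y: "inc Y a" "\<not> between Y R A" "Y \<noteq> R" "Y \<noteq> Z" for Y
    proof -
      have Yb: "\<not> inc Y b" using only Y by blast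
      then obtain y where y: "inc Y y" "\<not> meets y b" using miss_exists by blast
      have yb: "y \<noteq> b" using Yb y by blast
      have none: "\<not> inc X y" if "inc X b" for X using meetsI[of X y b] that y yb by blast
      have "y \<noteq> a" using none Za Zb by blast
      then have Ry: "\<not> inc R y" using line_unique[of R Y a y] r Y y by blast
      then obtain E where E: "inc E y" "between R E S" using H[OF y(1) Y(1,2)] none s by blast
      have Eb: "\<not> inc E b" using none E by blast
      then have Rb: "\<not> inc R b" using between_inc(2)[OF E(2)] s by blast
      have "same_side b E R" using same_side_between[of S b E R] s E between_sym Eb by blast
      moreover have "same_side b E Y" using same_side_if_missed[of E y Y b] E y yb by blast
      moreover have "same_side y Z S" using same_side_if_missed[of Z b S y] Zb s y yb meets_sym by blast
      moreover have "\<not> same_side y R S" using E same_sideD by blast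
      ultimately show ?thesis using y \<open>y \<noteq> a\<close> same_side_trans same_side_sym by blast
    qed
    obtain Y where Y: "between R Y A" using between_dense r by metis
    have Ya: "inc Y a" "\<not> between Y R A" "Y \<noteq> R" "Y \<noteq> A"
      using between_inc(2)[OF Y] r between_distinct[OF Y] between_unique[OF Y] by blast+
    have AA: "\<not> between A R A" using between_distinct by blast
    obtain W where W: "inc W a" "\<not> between W R A" "W \<noteq> R" "W \<noteq> Z"
      using Ya AA r by metis
    have "\<not> inc R b" using same[OF W] same_sideD by blast
    then have RZ: "R \<noteq> Z" using Zb by blast
    have ZRA: "between Z R A"
    proof (rule ccontr)
      assume n: "\<not> between Z R A"
      obtain V where V: "between R Z V" using between_extend RZ by metis
      have Va: "inc V a" using between_inc(1)[OF V] r Za by blast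
      have "\<not> between V R A"
      proof
        assume "between V R A"
        then have "between Z R A" using between_trans1[of V Z R A] V between_sym by blast
        then show False using n by blast
      qed
      then have "same_side b R V" using same[OF Va] between_distinct[OF V] by blast
      then show False using V Zb same_sideD by blast
    qed
    then obtain y where y: "inc A y" "y \<noteq> a" "\<not> same_side y R S" "same_side y Z S"
      using same[OF r(2) AA] r between_distinct[OF ZRA] by blast
    have "\<not> inc R y" using line_unique[of R A a y] r y by blast
    then have "\<not> same_side y R Z" using y same_side_trans by blast
    then have "\<exists>B'. inc B' y \<and> between R B' Z"
      using not_same_sideD \<open>\<not> inc R y\<close> y same_sideD by blast
    then obtain B' where B': "inc B' y" "between R B' Z" by blast
    then have "B' = A" using line_unique[of B' A a y] between_inc(2)[OF B'(2)] r y Za by blast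
    then show False using B' ZRA between_unique between_sym by blast
  qed
  have miss: "\<not> meets a b" "\<not> meets b a" using disj by (blast elim: meetsE)+
  have Rb: "\<not> inc R b" and Sa: "\<not> inc S a" and Ab: "\<not> inc A b" using disj r s by blast+
  have RS: "R \<noteq> S" using Rb s by blast
  obtain x where x: "inc R x" "inc S x" using join_exists by blast
  have Ax: "\<not> inc A x" using line_unique[of A R a x] r x Sa by blast
  obtain M m where m: "limiting R M m b" "same_side x M A"
    using limiting_exists[OF Rb s(1) x Ax] by blast
  note l = limitingD[OF m(1)]
  \<comment> \<open>Otherwise \<open>m\<close> separates \<open>A\<close> from \<open>S\<close>,
    since inside the angle \<open>a\<close> would meet \<open>b\<close>. A line through
    \<open>A\<close> missing \<open>m\<close> could then reach neither \<open>SB\<close> nor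
    \<open>RS\<close>, as these are on the other side of \<open>m\<close> or, for \<open>R\<close>,
    on \<open>m\<close>.\<close>
  have "m = a"
  proof (rule ccontr)
    assume ma: "m \<noteq> a"
    have "\<not> same_side m A S"
      using limiting_meets[OF m(1) s(1) _ x same_side_sym[OF m(2)] r(1,2)] miss by blast
    moreover have Am: "\<not> inc A m" using line_unique[of A R a m] r l ma by blast
    obtain k where k: "inc A k" "\<not> meets k m" using miss_exists Am by blast
    have km: "k \<noteq> m" using Am k by blast
    have kA: "same_side m A E" if "inc E k" for E
      using same_side_if_missed[of A k E m] that k km by blast
    have Sm: "\<not> inc S m" using meetsI[of S m b] l s by blast
    have bS: "same_side m Y S" if "inc Y b" for Y
      using same_side_if_missed[of Y b S m] that s l by blast
    have "\<not> between A R A" using between_distinct by blast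
    then consider Y where "inc Y k" "inc Y b" | "inc R k" | "inc S k" | E where "inc E k" "between R E S"
      using H[OF k(1) r(2)] by blast
    then have "same_side m A S"
    proof cases
      case 1 then show ?thesis using kA bS same_side_trans by blast
    next
      case 2 then show ?thesis using meetsI[of R k m] l k km by blast
    next
      case 3 then show ?thesis using kA by blast
    next
      case 4
      then have "same_side m E S" using same_side_between[of R m E S] l kA same_sideD by blast
      then show ?thesis using kA 4 same_side_trans by blast
    qed
    ultimately show False by blast
  qed
  then have la: "limiting R A a b"
    using limiting_ray[OF m(1)] r m x same_sideD by blast
  \<comment> \<open>Otherwise take \<open>D\<close> on the opposite ray. The line \<open>AD\<close>
    meets \<open>b\<close> only at \<open>D\<close>, so it has to cut \<open>RS\<close> at some
    \<open>E\<close>; but \<open>E\<close>, \<open>A\<close>, \<open>D\<close> admit no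
    order.\<close>
  have "same_side x A B"
  proof (rule ccontr)
    assume n: "\<not> same_side x A B"
    have Bx: "\<not> inc B x" using line_unique[of B S b x] s x Rb by blast
    obtain D where D: "between B S D" using between_extend s by metis
    have Db: "inc D b" "D \<noteq> S" using between_inc(1)[OF D] s between_distinct[OF D] by blast+
    have Dx: "\<not> inc D x" using line_unique[of D S b x] Db s x Rb by blast
    have "\<not> same_side x B D" using D x same_sideD by blast
    then have xAD: "same_side x A D" using two_sides n Ax Bx Dx by blast
    obtain k where k: "inc A k" "inc D k" using join_exists by blast
    have kab: "k \<noteq> a" "k \<noteq> b" using k Ab Db disj by blast+
    have "\<not> between A R A" using between_distinct by blast
    then consider Y where "inc Y k" "inc Y b" "\<not> between Y S B" | "inc R k" | "inc S k"
      | E where "inc E k" "between R E S"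
      using H[OF k(1) r(2)] by blast
    then show False
    proof cases
      case 1
      then have "Y = D" using line_unique[of Y D k b] k Db kab by blast
      then show ?thesis using 1 D between_sym by blast
    next
      case 2 then show ?thesis using line_unique[of R A k a] r k kab by blast
    next
      case 3 then show ?thesis using line_unique[of S D k b] s Db k kab by blast
    next
      case 4
      have Ex: "inc E x" using between_inc(2)[OF 4(2)] x by blast
      note dE = between_distinct[OF 4(2)]
      have Ea: "\<not> inc E a" using line_unique[of E R x a] Ex x r dE Sa by blast
      have Eb: "\<not> inc E b" using line_unique[of E S x b] Ex x s dE Rb by blast
      have "same_side a E S" using same_side_between[of R a E S] r 4 Ea by blast
      moreover have "same_side a S D" using same_side_if_missed[of S b D a] s Db miss ab by blast
      ultimately have "same_side a E D" using same_side_trans by blast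
      then have 1: "\<not> between E A D" using r same_sideD by blast
      have "same_side b E R" using same_side_between[of S b E R] s 4 between_sym Eb by blast
      moreover have "same_side b R A" using same_side_if_missed[of R a A b] r miss ab by blast
      ultimately have "same_side b E A" using same_side_trans by blast
      then have 2: "\<not> between E D A" using Db same_sideD by blast
      have 3: "\<not> between A E D" using xAD Ex same_sideD by blast
      have "E \<noteq> A" "E \<noteq> D" "A \<noteq> D" using Ex Ax Dx Ab Db by blast+
      then show ?thesis using trichotomy[of E A D k] 1 2 3 4 k between_sym by blast
    qed
  qed
  then show ?thesis unfolding asymptotic_def using la s x by blast
qed

lemma parallel_iff: "parallel a b \<longleftrightarrow> (\<exists>P A Q B. asymptotic P A a Q B b)"
proof
  assume "parallel a b"
  then obtain r s R S where rs: "r \<subseteq> pts a" "s \<subseteq> pts b" "ray_from R r" "ray_from S s"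
    "\<not> collinear_rays r s" "\<And>k. meets_set k r \<Longrightarrow> meets_set k s \<or> meets_set k (segment R S)"
    unfolding parallel_def parallel_rays_def by blast
  obtain A where A: "A \<noteq> R" "r = ray R A" using rs unfolding ray_from_def by blast
  obtain B where B: "B \<noteq> S" "s = ray S B" using rs unfolding ray_from_def by blast
  have "inc R a" "inc A a" "inc S b" "inc B b" using rs A B unfolding pts_def ray_def by blast+
  moreover have "a \<noteq> b" using rs unfolding collinear_rays_def by blast
  ultimately show "\<exists>P A Q B. asymptotic P A a Q B b"
    using parallel_rays_asymptotic[of R a A S b B] rs A B by blast
next
  assume "\<exists>P A Q B. asymptotic P A a Q B b"
  then obtain P A Q B where as: "asymptotic P A a Q B b" by blast
  note d = asymptoticD2[OF as]
  have "ray P A \<subseteq> pts a" "ray Q B \<subseteq> pts b"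
    using ray_iff[OF d(1-3)] ray_iff[OF d(4-6)] unfolding pts_def by blast+
  then show "parallel a b" unfolding parallel_def using asymptotic_parallel_rays[OF as] by blast
qed

lemma parallel_iff_end: "parallel a b \<longleftrightarrow> a \<noteq> b \<and> (\<exists>e. is_end e \<and> a \<in> e \<and> b \<in> e)"
proof
  assume "parallel a b"
  then obtain P A Q B where as: "asymptotic P A a Q B b" using parallel_iff by blast
  note d = asymptoticD2[OF as]
  have "is_end (pencil P A a)" unfolding is_end_def using d by blast
  moreover have "a \<in> pencil P A a" "b \<in> pencil P A a" unfolding pencil_def using as by blast+
  ultimately show "a \<noteq> b \<and> (\<exists>e. is_end e \<and> a \<in> e \<and> b \<in> e)" using d by blast
next
  assume "a \<noteq> b \<and> (\<exists>e. is_end e \<and> a \<in> e \<and> b \<in> e)"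
  moreover obtain P Q where "inc P a" "inc Q b" using A2 by meson
  ultimately show "parallel a b" using end_asymptotic parallel_iff by metis
qed

subsection \<open>Rimpoints\<close>

lemma end_side:
  assumes "is_end e" "a \<in> e" "b \<in> e" "a \<noteq> b" "inc A a" "inc A' a"
  shows "same_side b A A'"
  using same_side_if_missed end_not_meets assms by blast

lemma end_separates:
  assumes "is_end e" "a \<in> e" "b \<in> e" "c \<in> e" "a \<noteq> b" "a \<noteq> c" "b \<noteq> c" "inc A a" "inc B b" "inc C c"
  shows "\<not> same_side a B C \<or> \<not> same_side b A C \<or> \<not> same_side c A B"
proof -
  obtain D D' where 1: "asymptotic A D a B D' b" "e = pencil A D a"
    using end_asymptotic[of e a b A B] assms by blast
  obtain F F' where 2: "asymptotic A F a C F' c" "e = pencil A F a"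
    using end_asymptotic[of e a c A C] assms by blast
  have "b \<in> pencil A F a" using 2 assms by blast
  then obtain G G' where "asymptotic A F a G G' b" using assms unfolding pencil_def by blast
  then have "\<exists>B'. asymptotic A F a B B' b"
    using asymptotic_start[OF asymptotic_sym assms(9)] asymptotic_sym by blast
  then show ?thesis using asymptotic_separates 2 assms by blast
qed

text \<open>The lines \<open>a\<close> and \<open>b\<close> are outermost in \<open>F\<close>, so that a line joining them is a common transversal.\<close>

lemma end_extremes:
  assumes "finite F" "F \<noteq> {}" "is_end e" "F \<subseteq> e"
  shows "\<exists>a\<in>F. \<exists>b\<in>F. (a = b \<longrightarrow> F = {a}) \<and>
    (\<forall>f\<in>F. f \<noteq> a \<longrightarrow> f \<noteq> b \<longrightarrow> (\<forall>A B. inc A a \<longrightarrow> inc B b \<longrightarrow> \<not> same_side f A B))"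
  using assms(1,2,4)
proof (induction F rule: finite_ne_induct)
  case (singleton x)
  then show ?case by blast
next
  case (insert c F)
  then obtain a b where ab0: "a \<in> F" "b \<in> F" "a = b \<longrightarrow> F = {a}"
    "\<forall>f\<in>F. f \<noteq> a \<longrightarrow> f \<noteq> b \<longrightarrow> (\<forall>A B. inc A a \<longrightarrow> inc B b \<longrightarrow> \<not> same_side f A B)"
    by auto
  have ab: "a \<in> F" "b \<in> F" "a = b \<Longrightarrow> F = {a}"
    "f \<in> F \<Longrightarrow> f \<noteq> a \<Longrightarrow> f \<noteq> b \<Longrightarrow> inc A a \<Longrightarrow> inc B b \<Longrightarrow> \<not> same_side f A B" for f A B
    using ab0 by auto
  have e: "a \<in> e" "b \<in> e" "c \<in> e" "a \<noteq> c" "b \<noteq> c" "\<And>f. f \<in> F \<Longrightarrow> f \<in> e \<and> f \<noteq> c"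
    using insert ab by auto
  \<comment> \<open>If \<open>a'\<close> separates \<open>b'\<close> from \<open>c\<close>, then
    whatever separates \<open>a'\<close> from \<open>b'\<close> also separates \<open>c\<close> from
    \<open>b'\<close>. So \<open>c\<close> can take over the outermost position of
    \<open>a'\<close>.\<close>
  have replace: "\<not> same_side f C B"
    if h: "a' \<in> e" "b' \<in> e" "a' \<noteq> b'" "f \<in> e" "f \<noteq> a'" "f \<noteq> b'" "f \<noteq> c"  "a' \<noteq> c" "b' \<noteq> c"
      "\<And>A B. inc A a' \<Longrightarrow> inc B b' \<Longrightarrow> \<not> same_side f A B" "\<not> same_side a' B' C'"
      "inc B' b'" "inc C' c" "inc C c" "inc B b'"
    for a' b' f B B' C C'
  proof
    assume s: "same_side f C B"
    have "same_side a' B B'" "same_side a' C' C" using end_side[OF assms(3)] h e by metis+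
    then have "\<not> same_side a' B C" using h(11) same_side_trans same_side_sym by blast
    then obtain A' where A': "inc A' a'" "between B A' C"
      using not_same_sideD end_side[OF assms(3)] h e same_sideD by metis
    then show False using same_side_convex[OF same_side_sym[OF s]] h same_side_sym by blast
  qed
  obtain A where A: "inc A a" using A2 by blast
  obtain B where B: "inc B b" using A2 by blast
  obtain C where C: "inc C c" using A2 by blast
  show ?case
  proof (cases "a = b")
    case True
    then show ?thesis using ab(3) e by blast
  next
    case False
    consider "\<not> same_side c A B" | "\<not> same_side a B C" | "\<not> same_side b A C"
      using end_separates[OF assms(3) e(1,2,3) False e(4,5) A B C] by blast
    then show ?thesis
    proof cases
      case 1
      have "\<not> same_side c A' B'" if "inc A' a" "inc B' b" for A' B'
        using 1 end_side[OF assms(3)] e A B that same_side_trans by metis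
      then show ?thesis using False ab(4) by - (rule bexI[of _ a], rule bexI[of _ b], auto simp: ab(1,2))
    next
      case 2
      have "\<not> same_side f C' B'" if "f \<in> F" "f \<noteq> b" "inc C' c" "inc B' b" for f C' B'
      proof (cases "f = a")
        case True
        have "same_side a B B'" "same_side a C' C" using end_side[OF assms(3)] e B C that False by metis+
        then show ?thesis using 2 True same_side_trans same_side_sym by blast
      next
        case fa: False
        then show ?thesis
          using replace[OF e(1,2) False _ fa that(2) _ e(4,5) ab(4)[OF that(1) fa that(2)] 2 B C that(3,4)]
            that e by blast
      qed
      then have "\<forall>f\<in>insert c F. f \<noteq> c \<longrightarrow> f \<noteq> b \<longrightarrow>
          (\<forall>A B. inc A c \<longrightarrow> inc B b \<longrightarrow> \<not> same_side f A B)" by auto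
      moreover have "c = b \<longrightarrow> insert c F = {c}" "c \<in> insert c F" "b \<in> insert c F"
        using e(5) ab(2) by auto
      ultimately show ?thesis by blast
    next
      case 3
      have ab': "\<not> same_side f B' A'" if "f \<in> F" "f \<noteq> b" "f \<noteq> a" "inc A' a" "inc B' b" for f A' B'
        using ab(4) that same_side_sym by blast
      have "\<not> same_side f C' A'" if "f \<in> F" "f \<noteq> a" "inc C' c" "inc A' a" for f C' A'
      proof (cases "f = b")
        case True
        have "same_side b A A'" "same_side b C' C" using end_side[OF assms(3)] e A C that False by metis+
        then show ?thesis using 3 True same_side_trans same_side_sym by blast
      next
        case fb: False
        then show ?thesis
          using replace[OF e(2,1) False[symmetric] _ fb that(2) _ e(5,4) ab'[OF that(1) fb that(2)] 3 A C that(3,4)]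
            that e by blast
      qed
      then have "\<forall>f\<in>insert c F. f \<noteq> c \<longrightarrow> f \<noteq> a \<longrightarrow>
          (\<forall>A B. inc A c \<longrightarrow> inc B a \<longrightarrow> \<not> same_side f A B)" by auto
      moreover have "c = a \<longrightarrow> insert c F = {c}" "c \<in> insert c F" "a \<in> insert c F"
        using e(4) ab(1) by auto
      ultimately show ?thesis by blast
    qed
  qed
qed

lemma common_transversal:
  assumes "finite F" "is_end e" "F \<subseteq> e"
  shows "\<exists>t. \<forall>x\<in>F. meets t x"
proof (cases "F = {}")
  case False
  obtain a b where ab0: "a \<in> F" "b \<in> F" "a = b \<longrightarrow> F = {a}"
    "\<forall>f\<in>F. f \<noteq> a \<longrightarrow> f \<noteq> b \<longrightarrow> (\<forall>A B. inc A a \<longrightarrow> inc B b \<longrightarrow> \<not> same_side f A B)"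
    using end_extremes[OF assms(1) False assms(2,3)] by auto
  have ab: "a \<in> F" "b \<in> F" "a = b \<Longrightarrow> F = {a}"
    "f \<in> F \<Longrightarrow> f \<noteq> a \<Longrightarrow> f \<noteq> b \<Longrightarrow> inc A a \<Longrightarrow> inc B b \<Longrightarrow> \<not> same_side f A B" for f A B
    using ab0 by auto
  obtain A where A: "inc A a" using A2 by blast
  obtain B where B: "inc B b" using A2 by blast
  show ?thesis
  proof (cases "a = b")
    case True
    obtain t where "inc A t" "t \<noteq> a" using other_line A by blast
    then show ?thesis using ab(3)[OF True] meetsI A by blast
  next
    case False
    obtain t where t: "inc A t" "inc B t" using join_exists by blast
    have e: "\<not> inc A f" if "f \<in> F" "f \<noteq> a" for f
      using end_disjoint[OF assms(2), of f a A] that ab assms A by blast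
    have e': "\<not> inc B f" if "f \<in> F" "f \<noteq> b" for f
      using end_disjoint[OF assms(2), of f b B] that ab assms B by blast
    have "meets t f" if f: "f \<in> F" for f
    proof (cases "f = a \<or> f = b")
      case True
      then show ?thesis using meetsI[of A t a] meetsI[of B t b] t A B e e' ab False by blast
    next
      case nf: False
      then obtain X where X: "inc X f" "between A X B"
        using ab(4)[OF f _ _ A B] not_same_sideD e e' f by blast
      then have "inc X t" using between_inc(2) t by blast
      then show ?thesis using meetsI[of X t f] X t e f nf by blast
    qed
    then show ?thesis by blast
  qed
qed simp

lemma end_parallel: "is_end e \<Longrightarrow> a \<in> e \<Longrightarrow> b \<in> e \<Longrightarrow> a \<noteq> b \<Longrightarrow> parallel a b"
  using parallel_iff_end by blast

section \<open>Parallel lines with a common transversal\<close>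

lemma side_point:
  assumes "inc Y b" "inc Y x" "b \<noteq> x" "\<not> inc A x"
  shows "\<exists>D. inc D b \<and> same_side x A D"
proof -
  obtain D where D: "inc D b" "D \<noteq> Y" using second_point assms by blast
  obtain D' where D': "between D Y D'" using between_extend D by blast
  have "inc D' b" "D' \<noteq> Y" using between_inc(1)[OF D'] D assms between_distinct[OF D'] by blast+
  moreover have "\<not> inc D x" "\<not> inc D' x"
    using line_unique[of D Y b x] line_unique[of D' Y b x] D assms calculation by blast+
  moreover have "\<not> same_side x D D'" using D' assms same_sideD by blast
  ultimately show ?thesis using two_sides assms D by blast
qed

text \<open>Let \<open>a'\<close> carry the limiting ray from \<open>X\<close> to \<open>b\<close>
  on the side of \<open>A\<close>. If it were not \<open>a\<close>, it would enter the angle between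
  \<open>a\<close> and the transversal and meet \<open>c\<close>. Then \<open>X\<close> and
  \<open>Z\<close> would be joined by lines missing \<open>b\<close>, although \<open>Y\<close> is
  between them.\<close>

lemma transversal_middle:
  assumes g: "is_end g" "a \<in> g" "c \<in> g" "a \<noteq> c"
    and b: "\<not> meets b a" "\<not> meets b c" "b \<noteq> a" "b \<noteq> c"
    and XYZ: "inc X a" "inc Y b" "inc Z c" "between X Y Z"
  shows "b \<in> g"
proof -
  obtain A C where as: "asymptotic X A a Z C c" "g = pencil X A a"
    using end_asymptotic[OF g XYZ(1,3)] by blast
  note d = asymptoticD[OF as(1)] asymptoticD2[OF as(1)]
  obtain x where x: "inc X x" "inc Y x" "inc Z x" using between_line XYZ by blast
  have Xb: "\<not> inc X b" and Zb: "\<not> inc Z b" and Ya: "\<not> inc Y a"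
    using meetsI[of X b a] meetsI[of Z b c] meetsI[of Y b a] b XYZ by blast+
  have Za: "\<not> inc Z a" using d by blast
  have Ax: "\<not> inc A x" using line_unique[of A X a x] d x Za by blast
  obtain A' a' where a': "limiting X A' a' b" "same_side x A' A"
    using limiting_exists[OF Xb XYZ(2) x(1,2) Ax] by blast
  note l = limitingD[OF a'(1)]
  have YX: "Y \<noteq> X" using XYZ between_distinct by blast
  have "a' = a"
  proof (rule ccontr)
    assume "a' \<noteq> a"
    then have "same_side a' A Y \<or> same_side a A' Y"
      using ray_trichotomy[OF a'(2) l(2,1) d(7,8) _ x(1,2) YX] by blast
    moreover have "\<not> same_side a' A Y"
      using limiting_meets[OF a'(1) XYZ(2) _ x(1,2) same_side_sym[OF a'(2)] d(7,8)] b meets_sym by blast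
    ultimately have "same_side a A' Y" by blast
    moreover have "same_side a Y Z" using same_side_between[OF XYZ(1,4) Ya] .
    ultimately have "same_side a A' Z" using same_side_trans by blast
    then have "meets a' c" using limiting_meets[OF d(1,2) _ x(1,3) a'(2) l(2,1)] by blast
    then obtain T where T: "inc T a'" "inc T c" by (blast elim: meetsE)
    have "same_side b X T" "same_side b T Z"
      using same_side_if_missed[of X a' T b] same_side_if_missed[of T c Z b] T l XYZ b meets_sym by blast+
    then have "same_side b X Z" using same_side_trans by blast
    then show False using XYZ same_sideD by blast
  qed
  then have "limiting X A a b" using limiting_ray[OF a'(1), of A] a' x same_sideD d by blast
  moreover have "b \<noteq> x" using x Xb by blast
  then obtain D where "inc D b" "same_side x A D" using side_point[OF XYZ(2) x(2) _ Ax] by blast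
  ultimately have "asymptotic X A a Y D b" unfolding asymptotic_def using XYZ x by blast
  then show ?thesis using as unfolding pencil_def by blast
qed

text \<open>The line whose point on \<open>t\<close> is between the other two points belongs to the
  end that the other two lines share.\<close>

lemma transversal_common_end:
  assumes "parallel a b" "parallel b c" "parallel a c" "meets t a" "meets t b" "meets t c"
  shows "\<exists>g. is_end g \<and> a \<in> g \<and> b \<in> g \<and> c \<in> g"
proof -
  obtain e f g where e: "is_end e" "a \<in> e" "b \<in> e" and f: "is_end f" "b \<in> f" "c \<in> f"
    and g: "is_end g" "a \<in> g" "c \<in> g" and ne: "a \<noteq> b" "b \<noteq> c" "a \<noteq> c"
    using assms parallel_iff_end by metis
  obtain X where X: "inc X t" "inc X a" using assms by (blast elim: meetsE)
  obtain Y where Y: "inc Y t" "inc Y b" using assms by (blast elim: meetsE)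
  obtain Z where Z: "inc Z t" "inc Z c" using assms by (blast elim: meetsE)
  have m: "\<not> meets a b" "\<not> meets b a" "\<not> meets b c" "\<not> meets c b" "\<not> meets a c" "\<not> meets c a"
    using end_not_meets e f g by blast+
  have "X \<noteq> Y" "Y \<noteq> Z" "X \<noteq> Z"
    using end_disjoint[OF e] end_disjoint[OF f] end_disjoint[OF g] X Y Z ne by blast+
  then consider "between Y X Z" | "between X Y Z" | "between X Z Y"
    using trichotomy X Y Z by blast
  then show ?thesis
  proof cases
    case 1
    then have "a \<in> f" using transversal_middle[OF f ne(2) m(1,5) ne(1,3) Y(2) X(2) Z(2)] by blast
    then show ?thesis using f by blast
  next
    case 2
    then have "b \<in> g"
      using transversal_middle[OF g ne(3) m(2,3) ne(1)[symmetric] ne(2) X(2) Y(2) Z(2)] by blast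
    then show ?thesis using g by blast
  next
    case 3
    then have "c \<in> e"
      using transversal_middle[OF e ne(1) m(6,4) ne(3)[symmetric] ne(2)[symmetric] X(2) Z(2) Y(2)] by blast
    then show ?thesis using e by blast
  qed
qed

text \<open>The equivalence class of pairs that represents the end \<open>e\<close> as a
  rimpoint.\<close>

definition end_pairs :: "'l set \<Rightarrow> ('l \<times> 'l) set" where
  "end_pairs e = {(a, b). a \<in> e \<and> b \<in> e \<and> a \<noteq> b}"

lemma end_other_line:
  assumes "is_end e" "a \<in> e" shows "\<exists>b\<in>e. b \<noteq> a"
  using off_line end_line_exists assms by metis

lemma rimpair_iff: "is_rimpair (a, b) \<longleftrightarrow> (\<exists>e. is_end e \<and> (a, b) \<in> end_pairs e)"
proof
  assume "is_rimpair (a, b)"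
  then show "\<exists>e. is_end e \<and> (a, b) \<in> end_pairs e"
    unfolding is_rimpair_def end_pairs_def using parallel_iff_end[of a b] by blast
next
  assume "\<exists>e. is_end e \<and> (a, b) \<in> end_pairs e"
  then obtain e where e: "is_end e" "a \<in> e" "b \<in> e" "a \<noteq> b" unfolding end_pairs_def by auto
  obtain A where A: "inc A a" using A2 by blast
  obtain B where B: "inc B b" using A2 by blast
  have AB: "\<not> inc A b" "\<not> inc B a" using end_disjoint[OF e(1)] e A B by blast+
  then have "A \<noteq> B" using A by blast
  \<comment> \<open>The third line required of a rimpoint is drawn through a point between points of
    \<open>a\<close> and \<open>b\<close>; it differs from both because neither contains that
    point.\<close>
  then obtain R where R: "between A R B" using between_dense by metis
  obtain c where c: "c \<in> e" "inc R c" using end_line_exists e by blast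
  have "c \<noteq> a" "c \<noteq> b" using between_inc[OF R] c A B AB by blast+
  then have "parallel a b" "parallel c a" "parallel c b" using end_parallel e c by blast+
  moreover obtain t where "\<forall>x\<in>{a, b, c}. meets t x"
    using common_transversal[of "{a, b, c}" e] e c by blast
  ultimately show "is_rimpair (a, b)" unfolding is_rimpair_def by blast
qed

text \<open>The transversal in the definition forces \<open>l\<close> into an end common to
  \<open>a\<close> and \<open>b\<close>, and this is \<open>e\<close> because two lines share only
  one end.\<close>

lemma rimpair_inc_iff:
  assumes "is_end e" "(a, b) \<in> end_pairs e"
  shows "rimpair_inc (a, b) l \<longleftrightarrow> l \<in> e"
proof -
  have e: "a \<in> e" "b \<in> e" "a \<noteq> b" using assms unfolding end_pairs_def by auto
  show ?thesis
  proof
    assume "rimpair_inc (a, b) l"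
    then consider "l = a \<or> l = b"
      | t where "parallel l a" "parallel l b" "meets t a" "meets t b" "meets t l"
      unfolding rimpair_inc_def by auto
    then show "l \<in> e"
    proof cases
      case 2
      moreover have "parallel a b" using parallel_iff_end e assms by blast
      ultimately obtain g where "is_end g" "l \<in> g" "a \<in> g" "b \<in> g"
        using transversal_common_end by blast
      then show ?thesis using end_unique e assms by blast
    qed (use e in blast)
  next
    assume l: "l \<in> e"
    obtain t where "\<forall>x\<in>{a, b, l}. meets t x"
      using common_transversal[of "{a, b, l}" e] assms e l by blast
    then show "rimpair_inc (a, b) l"
      unfolding rimpair_inc_def using end_parallel[OF assms(1) l] e by auto
  qed
qed

text \<open>The common transversal makes each of \<open>c\<close> and \<open>d\<close> incident with
  the rimpoint \<open>(a, b)\<close>, so both lie in \<open>e\<close>; ends that share two lines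
  coincide.\<close>

lemma rim_eq_iff:
  assumes "is_end e" "(a, b) \<in> end_pairs e" "is_end f" "(c, d) \<in> end_pairs f"
  shows "rim_eq (a, b) (c, d) \<longleftrightarrow> e = f"
proof -
  have e: "a \<in> e" "b \<in> e" "a \<noteq> b" "c \<in> f" "d \<in> f" "c \<noteq> d"
    using assms unfolding end_pairs_def by auto
  show ?thesis
  proof
    assume r: "rim_eq (a, b) (c, d)"
    obtain t where t: "\<forall>x\<in>{a, b, c, d}. meets t x"
      and p: "\<forall>x\<in>{a, b, c, d}. \<forall>y\<in>{a, b, c, d}. x = y \<or> parallel x y"
      using r unfolding rim_eq_def split_conv by blast
    have "x \<in> e" if x: "x \<in> {c, d}" for x
    proof -
      have "meets t a" "meets t b" "meets t x" "x = a \<or> parallel x a" "x = b \<or> parallel x b"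
        using t p x by blast+
      then have "x = a \<or> x = b \<or> rimpair_inc (a, b) x" unfolding rimpair_inc_def by blast
      then show ?thesis using rimpair_inc_iff[OF assms(1,2)] e by blast
    qed
    then show "e = f" using end_unique e assms by blast
  next
    assume "e = f"
    moreover obtain t where "\<forall>x\<in>{a, b, c, d}. meets t x"
      using common_transversal[of "{a, b, c, d}" e] assms e calculation by blast
    ultimately show "rim_eq (a, b) (c, d)"
      unfolding rim_eq_def using end_parallel[OF assms(1)] e by auto
  qed
qed

lemma rimpoints_eq: "rimpoints = end_pairs ` Collect is_end"
proof -
  have cls: "rim_rel `` {(a, b)} = end_pairs e" if "is_end e" "(a, b) \<in> end_pairs e" for a b e
  proof -
    have "(c, d) \<in> rim_rel `` {(a, b)} \<longleftrightarrow> (c, d) \<in> end_pairs e" for c d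
    proof -
      have "(c, d) \<in> rim_rel `` {(a, b)} \<longleftrightarrow> is_rimpair (c, d) \<and> rim_eq (a, b) (c, d)"
        unfolding rim_rel_def using rimpair_iff that by blast
      also have "\<dots> \<longleftrightarrow> (\<exists>f. is_end f \<and> (c, d) \<in> end_pairs f \<and> e = f)"
        using rimpair_iff rim_eq_iff that by blast
      finally show ?thesis using that by blast
    qed
    then show ?thesis by auto
  qed
  show ?thesis
  proof
    show "rimpoints \<subseteq> end_pairs ` Collect is_end"
    proof
      fix X assume "X \<in> rimpoints"
      then obtain a b where ab: "is_rimpair (a, b)" "X = rim_rel `` {(a, b)}"
        unfolding rimpoints_def quotient_def by auto
      then obtain e where "is_end e" "(a, b) \<in> end_pairs e" using rimpair_iff by blast
      then show "X \<in> end_pairs ` Collect is_end" using cls ab by blast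
    qed
    show "end_pairs ` Collect is_end \<subseteq> rimpoints"
    proof
      fix X assume "X \<in> end_pairs ` Collect is_end"
      then obtain e where e: "is_end e" "X = end_pairs e" by blast
      obtain a where "a \<in> e" using end_line_exists e by blast
      then obtain b where "(a, b) \<in> end_pairs e"
        using end_other_line e unfolding end_pairs_def by blast
      moreover then have "is_rimpair (a, b)" using rimpair_iff e by blast
      ultimately show "X \<in> rimpoints" unfolding rimpoints_def quotient_def using cls e by blast
    qed
  qed
qed

lemma end_has_pair:
  assumes "is_end e" "a \<in> e" shows "\<exists>b. (a, b) \<in> end_pairs e"
  using end_other_line[OF assms] assms unfolding end_pairs_def by auto

lemma end_pairs_inject:
  assumes "is_end e" "is_end f" "end_pairs e = end_pairs f" shows "e = f"
proof -
  obtain a where a: "a \<in> e" using end_line_exists assms by blast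
  obtain b where "(a, b) \<in> end_pairs e" using end_has_pair assms a by blast
  then show ?thesis using end_unique assms unfolding end_pairs_def by blast
qed

lemma rim_inc_iff:
  assumes "is_end e" shows "rim_inc (end_pairs e) l \<longleftrightarrow> l \<in> e"
proof
  assume "rim_inc (end_pairs e) l"
  then show "l \<in> e" unfolding rim_inc_def using rimpair_inc_iff assms by auto
next
  assume l: "l \<in> e"
  then obtain b where "(l, b) \<in> end_pairs e" using end_has_pair assms by blast
  then show "rim_inc (end_pairs e) l" unfolding rim_inc_def using rimpair_inc_iff assms l by blast
qed

section \<open>Half-turns\<close>

lemma halfturn_end:
  assumes "is_end e" "is_end f" "e \<noteq> f" "inc P l" "l \<in> e" "l \<in> f"
  shows "halfturn P (end_pairs e) = end_pairs f"
  unfolding halfturn_def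
proof (rule the_equality)
  show "end_pairs f \<in> rimpoints \<and> end_pairs f \<noteq> end_pairs e \<and>
      (\<exists>l. inc P l \<and> rim_inc (end_pairs e) l \<and> rim_inc (end_pairs f) l)"
    using rimpoints_eq end_pairs_inject[of f e] rim_inc_iff[of e] rim_inc_iff[of f] assms by auto
next
  \<comment> \<open>Any candidate uses the only line of \<open>e\<close> through \<open>P\<close>,
    which is \<open>l\<close>, and \<open>l\<close> has just one end besides
    \<open>e\<close>.\<close>
  fix Y assume Y: "Y \<in> rimpoints \<and> Y \<noteq> end_pairs e \<and>
    (\<exists>l. inc P l \<and> rim_inc (end_pairs e) l \<and> rim_inc Y l)"
  then obtain g where g: "is_end g" "Y = end_pairs g" using rimpoints_eq by auto
  then have "g \<noteq> e" using Y by blast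
  obtain k where k: "inc P k" "k \<in> e" "k \<in> g" using Y g rim_inc_iff[of e] rim_inc_iff[of g] assms by blast
  then have "k = l" using end_disjoint assms by blast
  then show "Y = end_pairs f" using line_two_ends[of l] g k assms \<open>g \<noteq> e\<close> by metis
qed

lemma halfturn_obtain:
  assumes "is_end e"
  obtains f l where "is_end f" "f \<noteq> e" "inc P l" "l \<in> e" "l \<in> f" "halfturn P (end_pairs e) = end_pairs f"
proof -
  obtain l where l: "l \<in> e" "inc P l" using end_line_exists assms by blast
  obtain f where "is_end f" "f \<noteq> e" "l \<in> f" using line_two_ends[of l] by metis
  then show thesis using that l halfturn_end[OF assms] by metis
qed

lemma halfturn_involution:
  "is_end e \<Longrightarrow> halfturn P (halfturn P (end_pairs e)) = end_pairs e"
  using halfturn_obtain halfturn_end by metis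

lemma halfturns_collinear:
  assumes "P \<noteq> Q"
    and inv: "\<And>X. X \<in> rimpoints \<Longrightarrow>
      halfturn R (halfturn Q (halfturn P (halfturn R (halfturn Q (halfturn P X))))) = X"
  shows "collinear P Q R"
proof -
  obtain l where l: "inc P l" "inc Q l" using join_exists by blast
  obtain u v where uv: "is_end u" "is_end v" "u \<noteq> v" "l \<in> u" "l \<in> v" using line_two_ends by blast
  have "halfturn Q (halfturn P (end_pairs u)) = end_pairs u" using halfturn_end uv l by metis
  moreover obtain d m where d: "is_end d" "d \<noteq> u" "inc R m" "m \<in> u" "m \<in> d"
    "halfturn R (end_pairs u) = end_pairs d" using halfturn_obtain uv by blast
  \<comment> \<open>The product sends \<open>u\<close> to \<open>d\<close>, so, being an involution,
    it sends \<open>d\<close> back to \<open>u\<close>.\<close>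
  ultimately have "halfturn R (halfturn Q (halfturn P (end_pairs d))) = end_pairs u"
    using inv rimpoints_eq uv by (metis image_eqI mem_Collect_eq)
  moreover obtain g p where g: "is_end g" "g \<noteq> d" "inc P p" "p \<in> d" "p \<in> g"
    "halfturn P (end_pairs d) = end_pairs g" using halfturn_obtain d by blast
  moreover obtain h q where h: "is_end h" "h \<noteq> g" "inc Q q" "q \<in> g" "q \<in> h"
    "halfturn Q (end_pairs g) = end_pairs h" using halfturn_obtain g by blast
  \<comment> \<open>Applying the half-turn about \<open>R\<close> to both sides cancels it on the
    left and turns \<open>u\<close> into \<open>d\<close> on the right.\<close>
  ultimately have "end_pairs h = end_pairs d" using halfturn_involution d by metis
  then have "h = d" using end_pairs_inject h d by blast
  \<comment> \<open>Both lines belong to the distinct ends \<open>d\<close> and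
    \<open>g\<close>.\<close>
  then have "p = q" using end_unique[of d g p q] g h d by blast
  then have "p = l" using line_unique[of P Q p l] g h l assms by blast
  then have "m = l" using end_unique[of u d m l] g d uv by blast
  then show ?thesis unfolding collinear_def using l d by blast
qed

end

text \<open>Products of half-turns are read from left to right, whereas \<open>\<circ>\<close>
  applies its right factor first; hence the reversed order of the factors.\<close>

theorem theorem3p1:
  fixes inc :: "'p \<Rightarrow> 'l \<Rightarrow> bool" and P Q R :: 'p
  defines "PQR \<equiv> incidence_structure.halfturn inc R \<circ> incidence_structure.halfturn inc Q \<circ>
      incidence_structure.halfturn inc P"
  assumes "hyperbolic_plane inc"
    and "distinct [P, Q, R]"
    and "\<forall>X \<in> incidence_structure.rimpoints inc. (PQR ^^ 2) X = X"
  shows "incidence_structure.collinear inc P Q R"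
proof -
  interpret hyperbolic_plane inc by fact
  show ?thesis
    using halfturns_collinear[of P Q R] assms(3,4) unfolding PQR_def by (simp add: numeral_2_eq_2)
qed

end
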